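(* Let $W=W_{A_{n-1}}$ and let $M$ be a $K$-module. The action of $y_i$ on the $\ddot{\mathfrak H}^{\mathfrak c}_W$-module $\mathbb C[x_1,\dots,x_n]\otimes M$ is realized as a Dunkl operator as follows. For any polynomial $f\in\mathbb C[x_1,\dots,x_n]$ and $m\in M$, $$y_i\circ(f\otimes m)=-u\sum_{k\ne i}\left(\frac{f-f^{s_{ki}}}{x_i-x_k}+\frac{f c_kc_i-c_kc_i f^{s_{ki}}}{x_i+x_k}\right)\otimes s_{ki}m .$$
   Context: Ground field $\mathbb C$, $u\in\mathbb C$. $W=W_{A_{n-1}}=S_n$, $s_{ij}$ the transposition of $i,j$. $\mathcal C_n$ is generated by $c_1,\dots,c_n$ with $c_i^2=1$, $c_ic_j=-c_jc_i$ ($i\ne j$); $S_n$ permutes the $c_i$. $K=\mathcal C_n\rtimes\mathbb CW$. The rational double affine Hecke-Clifford algebra $\ddot{\mathfrak H}^{\mathfrak c}_W$ of type $A_{n-1}$ is generated by $x_i,y_i,c_i$ ($1\le i\le n$) and $W$, subject to the relations of $K$ and: $x_ix_j=x_jx_i$, $y_iy_j=y_jy_i$, $y_ic_j=c_jy_i$ (all $i,j$); $x_ic_i=-c_ix_i$, $x_ic_j=c_jx_i$ ($i\ne j$); $wx_iw^{-1}=x_{w(i)}$, $wy_iw^{-1}=y_{w(i)}$ ($w\in W$); $[y_j,x_i]=u(1+c_jc_i)s_{ji}$ ($i\ne j$); $[y_i,x_i]=-u\sum_{k\ne i}(1+c_kc_i)s_{ki}$. It has the triangular decomposition $\mathbb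 C[x_1,\dots,x_n]\otimes K\otimes\mathbb C[y_1,\dots,y_n]$. Let $\mathfrak H_y$ be the subalgebra generated by $K$ and $y_1,\dots,y_n$. A $K$-module $M$ is extended to an $\mathfrak H_y$-module by letting all $y_i$ act by $0$, and $M_y=\mathrm{Ind}_{\mathfrak H_y}^{\ddot{\mathfrak H}^{\mathfrak c}_W}M$ is identified as a vector space with $\mathbb C[x_1,\dots,x_n]\otimes M$; this is the module structure in question ($\circ$ denotes the action; $x_i$ acts by left multiplication). $f^\sigma$ denotes the action of $\sigma\in W$ on a polynomial $f$. Products such as $fc_kc_i$ and $c_kc_if^{s_{ki}}$ are taken in the subalgebra generated by the $x_j$ and $c_j$, and $\frac hg$ means $\frac1g\cdot h$. An expression $(p\,a)\otimes m$ with $p\in\mathbb C[x_1,\dots,x_n]$, $a\in\mathcal C_n$ means $p\otimes am$ (extended linearly). *)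

theory Defs
  imports Complex_Main "HOL-Library.Poly_Mapping" "HOL-Combinatorics.Perm"
begin

section \<open>Complex algebras and modules\<close>

locale complex_algebra = vector_space scale
  for scale :: "complex \<Rightarrow> 'a::ring_1 \<Rightarrow> 'a" +
  assumes mult_scale_left: "scale z a * b = scale z (a * b)"
    and mult_scale_right: "a * scale z b = scale z (a * b)"

locale algebra_hom = A: complex_algebra scaleA + B: complex_algebra scaleB
  + Vector_Spaces.linear scaleA scaleB h
  for scaleA :: "complex \<Rightarrow> 'a::ring_1 \<Rightarrow> 'a"
    and scaleB :: "complex \<Rightarrow> 'b::ring_1 \<Rightarrow> 'b"
    and h :: "'a \<Rightarrow> 'b" +
  assumes hom_mult: "h (a * b) = h a * h b"
    and hom_one: "h 1 = 1"

inductive_set generated_subalgebra ::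
    "(complex \<Rightarrow> 'a::ring_1 \<Rightarrow> 'a) \<Rightarrow> 'a set \<Rightarrow> 'a set"
  for scale :: "complex \<Rightarrow> 'a \<Rightarrow> 'a" and S :: "'a set"
where
  gen: "a \<in> S \<Longrightarrow> a \<in> generated_subalgebra scale S"
| one: "1 \<in> generated_subalgebra scale S"
| add: "a \<in> generated_subalgebra scale S \<Longrightarrow> b \<in> generated_subalgebra scale S
    \<Longrightarrow> a + b \<in> generated_subalgebra scale S"
| mult: "a \<in> generated_subalgebra scale S \<Longrightarrow> b \<in> generated_subalgebra scale S
    \<Longrightarrow> a * b \<in> generated_subalgebra scale S"
| scale: "a \<in> generated_subalgebra scale S \<Longrightarrow> scale z a \<in> generated_subalgebra scale S"

text \<open>Left modules over a subalgebra \<open>S\<close>; values of \<open>act\<close> outside \<open>S\<close> are irrelevant.\<close>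

locale algebra_module = A: complex_algebra scaleA + M: vector_space scaleM
  for scaleA :: "complex \<Rightarrow> 'a::ring_1 \<Rightarrow> 'a"
    and S :: "'a set"
    and scaleM :: "complex \<Rightarrow> 'm::ab_group_add \<Rightarrow> 'm"
    and act :: "'a \<Rightarrow> 'm \<Rightarrow> 'm" +
  assumes act_add_right: "a \<in> S \<Longrightarrow> act a (m + m') = act a m + act a m'"
    and act_scale_right: "a \<in> S \<Longrightarrow> act a (scaleM z m) = scaleM z (act a m)"
    and act_add_left: "a \<in> S \<Longrightarrow> b \<in> S \<Longrightarrow> act (a + b) m = act a m + act b m"
    and act_scale_left: "a \<in> S \<Longrightarrow> act (scaleA z a) m = scaleM z (act a m)"
    and act_one: "act 1 m = m"
    and act_mult: "a \<in> S \<Longrightarrow> b \<in> S \<Longrightarrow> act (a * b) m = act a (act b m)"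

text \<open>Scalar multiplication on finitely supported complex functions: on free vector spaces,
  free algebras and polynomial rings.\<close>

definition fscale :: "complex \<Rightarrow> ('a \<Rightarrow>\<^sub>0 complex) \<Rightarrow> ('a \<Rightarrow>\<^sub>0 complex)" where
  "fscale z = Poly_Mapping.map (\<lambda>a. z * a)"


section \<open>Presentations by generators and relations\<close>

datatype 'g word = Word (letters: "'g list")

instantiation word :: (type) monoid_add
begin

definition zero_word :: "'a word" where
  "0 = Word []"

definition plus_word :: "'a word \<Rightarrow> 'a word \<Rightarrow> 'a word" where
  "v + w = Word (letters v @ letters w)"

instance
  by standard (auto simp: zero_word_def plus_word_def)

end

text \<open>The convolution product of finitely supported functions on words makes this the
  free unital algebra on \<open>'g\<close>.\<close>

type_synonym 'g free_algebra = "'g word \<Rightarrow>\<^sub>0 complex"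

definition fgen :: "'g \<Rightarrow> 'g free_algebra" where
  "fgen g = Poly_Mapping.single (Word [g]) 1"

definition free_eval ::
    "(complex \<Rightarrow> 'a::ring_1 \<Rightarrow> 'a) \<Rightarrow> ('g \<Rightarrow> 'a) \<Rightarrow> 'g free_algebra \<Rightarrow> 'a" where
  "free_eval scale \<gamma> p =
    (\<Sum>v\<in>Poly_Mapping.keys p. scale (Poly_Mapping.lookup p v) (prod_list (map \<gamma> (letters v))))"

inductive_set generated_ideal :: "'a::ring_1 set \<Rightarrow> 'a set" for R :: "'a set"
where
  gen: "r \<in> R \<Longrightarrow> r \<in> generated_ideal R"
| zero: "0 \<in> generated_ideal R"
| add: "a \<in> generated_ideal R \<Longrightarrow> b \<in> generated_ideal R \<Longrightarrow> a + b \<in> generated_ideal R"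
| mult_left: "a \<in> generated_ideal R \<Longrightarrow> b * a \<in> generated_ideal R"
| mult_right: "a \<in> generated_ideal R \<Longrightarrow> a * b \<in> generated_ideal R"

text \<open>The algebra \<open>'a\<close>, with generators \<open>\<gamma>\<close>, is the quotient of the free algebra by the
  two-sided ideal generated by \<open>R\<close>.  This pins down \<open>'a\<close> up to a unique isomorphism that
  respects the generators.\<close>

locale presented_algebra = complex_algebra scale
  for scale :: "complex \<Rightarrow> 'a::ring_1 \<Rightarrow> 'a"
    and \<gamma> :: "'g \<Rightarrow> 'a"
    and R :: "'g free_algebra set" +
  assumes surjective: "range (free_eval scale \<gamma>) = UNIV"
    and kernel: "{p. free_eval scale \<gamma> p = 0} = generated_ideal R"


section \<open>Induced modules\<close>

definition tensor_relators ::
    "(complex \<Rightarrow> 'a::ring_1 \<Rightarrow> 'a) \<Rightarrow> (complex \<Rightarrow> 'm::ab_group_add \<Rightarrow> 'm) \<Rightarrow>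
     'a set \<Rightarrow> ('a \<Rightarrow> 'm \<Rightarrow> 'm) \<Rightarrow> ('a \<times> 'm \<Rightarrow>\<^sub>0 complex) set" where
  "tensor_relators scaleA scaleM S act =
    (let e = (\<lambda>a m. Poly_Mapping.single (a, m) (1::complex)) in
      {e (a + b) m - e a m - e b m | a b m. True} \<union>
      {e a (m + m') - e a m - e a m' | a m m'. True} \<union>
      {e (scaleA z a) m - fscale z (e a m) | z a m. True} \<union>
      {e a (scaleM z m) - fscale z (e a m) | z a m. True} \<union>
      {e (a * b) m - e a (act b m) | a b m. b \<in> S})"

text \<open>\<open>'v\<close> is the tensor product \<open>'a \<otimes>\<^sub>S 'm\<close>, that is, the free vector space on \<open>'a \<times> 'm\<close>
  modulo the span of the tensor relators, with \<open>tens a m\<close> the class of \<open>(a, m)\<close>; the algebra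
  acts on the left tensor factor.\<close>

locale induced_module =
  M: algebra_module scaleA S scaleM actM + V: algebra_module scaleA UNIV scaleV actV
  for scaleA :: "complex \<Rightarrow> 'a::ring_1 \<Rightarrow> 'a"
    and S :: "'a set"
    and scaleM :: "complex \<Rightarrow> 'm::ab_group_add \<Rightarrow> 'm"
    and actM :: "'a \<Rightarrow> 'm \<Rightarrow> 'm"
    and scaleV :: "complex \<Rightarrow> 'v::ab_group_add \<Rightarrow> 'v"
    and actV :: "'a \<Rightarrow> 'v \<Rightarrow> 'v"
    and tens :: "'a \<Rightarrow> 'm \<Rightarrow> 'v" +
  assumes tensor_surjective:
      "range (\<lambda>p. \<Sum>(a, m)\<in>Poly_Mapping.keys p.
          scaleV (Poly_Mapping.lookup p (a, m)) (tens a m)) = UNIV"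
    and tensor_kernel:
      "{p. (\<Sum>(a, m)\<in>Poly_Mapping.keys p.
          scaleV (Poly_Mapping.lookup p (a, m)) (tens a m)) = 0}
        = module.span fscale (tensor_relators scaleA scaleM S actM)"
    and act_tensor: "actV a (tens b m) = tens (a * b) m"


section \<open>The rational double affine Hecke-Clifford algebra of type A\<close>

text \<open>The index set \<open>{1, \<dots>, n}\<close> is a finite type \<open>'n\<close>, so that \<open>S\<^sub>n\<close> is \<open>'n perm\<close> (whose product
  is composition).\<close>

unbundle permutation_syntax

datatype 'n kgen = KC 'n | KW "'n perm"
datatype 'n hgen = HX 'n | HY 'n | HC 'n | HW "'n perm"

text \<open>Relations of the semidirect product of the Clifford algebra with the group algebra of
  \<open>S\<^sub>n\<close>.\<close>

definition K_relators :: "('n \<Rightarrow> 'a::ring_1) \<Rightarrow> ('n perm \<Rightarrow> 'a) \<Rightarrow> 'a set" where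
  "K_relators c w =
     {c i * c i - 1 | i. True} \<union>
     {c i * c j + c j * c i | i j. i \<noteq> j} \<union>
     {w 1 - 1} \<union>
     {w (\<sigma> * \<tau>) - w \<sigma> * w \<tau> | \<sigma> \<tau>. True} \<union>
     {w \<sigma> * c i * w (inverse \<sigma>) - c (\<sigma> \<langle>$\<rangle> i) | \<sigma> i. True}"

definition DAHCA_relators ::
    "'a \<Rightarrow> ('n::finite \<Rightarrow> 'a::ring_1) \<Rightarrow> ('n \<Rightarrow> 'a) \<Rightarrow> ('n \<Rightarrow> 'a) \<Rightarrow> ('n perm \<Rightarrow> 'a) \<Rightarrow> 'a set"
where
  "DAHCA_relators u x y c w =
     K_relators c w \<union>
     {x i * x j - x j * x i | i j. True} \<union>
     {y i * y j - y j * y i | i j. True} \<union>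
     {y i * c j - c j * y i | i j. True} \<union>
     {x i * c i + c i * x i | i. True} \<union>
     {x i * c j - c j * x i | i j. i \<noteq> j} \<union>
     {w \<sigma> * x i * w (inverse \<sigma>) - x (\<sigma> \<langle>$\<rangle> i) | \<sigma> i. True} \<union>
     {w \<sigma> * y i * w (inverse \<sigma>) - y (\<sigma> \<langle>$\<rangle> i) | \<sigma> i. True} \<union>
     {(y j * x i - x i * y j) - u * (1 + c j * c i) * w \<langle>j \<leftrightarrow> i\<rangle> | i j. i \<noteq> j} \<union>
     {(y i * x i - x i * y i) + u * (\<Sum>k\<in>-{i}. (1 + c k * c i) * w \<langle>k \<leftrightarrow> i\<rangle>) | i. True}"

locale clifford_semidirect_algebra =
  presented_algebra scale \<gamma> "K_relators (\<lambda>i. fgen (KC i)) (\<lambda>\<sigma>. fgen (KW \<sigma>))"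
  for scale :: "complex \<Rightarrow> 'k::ring_1 \<Rightarrow> 'k"
    and \<gamma> :: "'n::finite kgen \<Rightarrow> 'k"

text \<open>In the free algebra the scalar \<open>u\<close> is \<open>u\<close> times the empty word.\<close>

locale rational_DAHCA =
  presented_algebra scale \<gamma>
    "DAHCA_relators (Poly_Mapping.single 0 u)
       (\<lambda>i. fgen (HX i)) (\<lambda>i. fgen (HY i)) (\<lambda>i. fgen (HC i)) (\<lambda>\<sigma>. fgen (HW \<sigma>))"
  for u :: complex
    and scale :: "complex \<Rightarrow> 'h::ring_1 \<Rightarrow> 'h"
    and \<gamma> :: "'n::finite hgen \<Rightarrow> 'h"


section \<open>Polynomials and fractions\<close>

text \<open>A polynomial maps exponent vectors to coefficients.\<close>

type_synonym 'n mpoly = "('n \<Rightarrow>\<^sub>0 nat) \<Rightarrow>\<^sub>0 complex"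

definition mvar :: "'n \<Rightarrow> 'n mpoly" where
  "mvar i = Poly_Mapping.single (Poly_Mapping.single i 1) 1"

text \<open>\<open>\<sigma>\<close> acts by the substitution of \<open>x\<^bsub>\<sigma>(i)\<^esub>\<close> for \<open>x\<^sub>i\<close>: the coefficient of \<open>x\<^bsup>\<beta>\<^esup>\<close> in the result
  is the coefficient of \<open>x\<^bsup>\<beta> \<circ> \<sigma>\<^esup>\<close> in \<open>f\<close>.\<close>

definition perm_mpoly :: "'n perm \<Rightarrow> 'n mpoly \<Rightarrow> 'n mpoly" where
  "perm_mpoly \<sigma> f = Poly_Mapping.map_key (Poly_Mapping.map_key (\<lambda>i. \<sigma> \<langle>$\<rangle> i)) f"

text \<open>The fraction \<open>h / g = (1 / g) h\<close> in \<open>S\<close>: the unique \<open>q \<in> S\<close> with \<open>g q = h\<close>.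
  Note the order of the arguments: numerator first.\<close>

definition left_fraction :: "'a::ring_1 set \<Rightarrow> 'a \<Rightarrow> 'a \<Rightarrow> 'a" where
  "left_fraction S h g = (THE q. q \<in> S \<and> g * q = h)"

end

theory Submission
  imports Defs "HOL-Computational_Algebra.Polynomial"
begin

text \<open>Pushing \<open>y\<^sub>i\<close> through a polynomial one variable at a time produces the numerators of the
  formula, together with elements \<open>q\<close> that solve \<open>(x\<^sub>i \<plusminus> x\<^sub>k) q = h\<close>.  That these \<open>q\<close> are the
  fractions requires that \<open>x\<^sub>i \<plusminus> x\<^sub>k\<close> can be cancelled in the subalgebra generated by the \<open>x\<^sub>j\<close> and
  \<open>c\<^sub>j\<close>, a part of the PBW theorem.

  For this, let \<open>y\<^sub>i\<close> act on functions on a regular orbit of the group of signed permutations, with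
  values in \<open>K\<close>, as \<open>u \<Sum>\<^sub>k ((x\<^sub>i - x\<^sub>k)\<^sup>-\<^sup>1 + (x\<^sub>i + x\<^sub>k)\<^sup>-\<^sup>1 c\<^sub>k c\<^sub>i) s\<^sub>k\<^sub>i\<close>, the Dunkl operator without its
  first term.  These operators commute because the coefficients satisfy an associative Yang-Baxter
  equation.  So the algebra acts, \<open>x\<^sub>i \<plusminus> x\<^sub>k\<close> acts invertibly, and an element \<open>\<Sum>\<^sub>S p\<^sub>S c\<^sub>S\<close> that acts by
  zero on all regular orbits, \<open>c\<^sub>S\<close> being the product of the \<open>c\<^sub>j\<close> with \<open>j \<in> S\<close>, has \<open>p\<^sub>S = 0\<close>,
  because the \<open>c\<^sub>S\<close> permute the points of the orbit
  differently.\<close>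

section \<open>Free algebras and presentations\<close>

lemma lookup_fscale [simp]:
  "Poly_Mapping.lookup (fscale z p) k = z * Poly_Mapping.lookup p k"
  by (simp add: fscale_def Poly_Mapping.map.rep_eq when_def)

lemma fscale_single [simp]: "fscale z (Poly_Mapping.single k a) = Poly_Mapping.single k (z * a)"
  by (rule poly_mapping_eqI) (simp add: lookup_single when_def)

lemma poly_mapping_induct_single_add [case_names single add]:
  fixes p :: "'k \<Rightarrow>\<^sub>0 'b::comm_monoid_add"
  assumes single: "\<And>k a. P (Poly_Mapping.single k a)"
    and add: "\<And>p q. P p \<Longrightarrow> P q \<Longrightarrow> P (p + q)"
  shows "P p"
proof (induction p rule: update_induct)
  case const
  \<comment> \<open>The zero mapping is a \<open>single\<close> with coefficient 0, whatever the
    key.\<close>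
  from single[of undefined 0] show ?case by simp
next
  case (update p k a)
  have "Poly_Mapping.update k a p = p + Poly_Mapping.single k a"
    using update(1) by (intro poly_mapping_eqI)
      (auto simp: lookup_update lookup_add lookup_single when_def in_keys_iff)
  then show ?case using update(3) single add by simp
qed

lemma vector_space_fscale: "vector_space (fscale :: complex \<Rightarrow> ('k \<Rightarrow>\<^sub>0 complex) \<Rightarrow> _)"
  by standard (auto intro!: poly_mapping_eqI simp: lookup_add algebra_simps)

text \<open>Linear extension from a basis. Evaluation of the free algebra, evaluation of polynomials
  and the class map of the tensor product are instances, so linearity is proved once for all
  three.\<close>

definition lin_ext :: "(complex \<Rightarrow> 'v::ab_group_add \<Rightarrow> 'v) \<Rightarrow> ('k \<Rightarrow> 'v) \<Rightarrow> ('k \<Rightarrow>\<^sub>0 complex) \<Rightarrow> 'v"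
  where "lin_ext scale g p =
    (\<Sum>k\<in>Poly_Mapping.keys p. scale (Poly_Mapping.lookup p k) (g k))"

context
  fixes scale :: "complex \<Rightarrow> 'v::ab_group_add \<Rightarrow> 'v"
  assumes V: "vector_space scale"
begin

interpretation vector_space scale by (fact V)

lemma lin_ext_superset:
  assumes "finite A" "Poly_Mapping.keys p \<subseteq> A"
  shows "lin_ext scale g p = (\<Sum>k\<in>A. scale (Poly_Mapping.lookup p k) (g k))"
  unfolding lin_ext_def using assms
  by (intro sum.mono_neutral_left) (auto simp: in_keys_iff)

lemma lin_ext_add: "lin_ext scale g (p + q) = lin_ext scale g p + lin_ext scale g q"
proof -
  let ?A = "Poly_Mapping.keys p \<union> Poly_Mapping.keys q"
  have "Poly_Mapping.keys (p + q) \<subseteq> ?A" by (rule keys_add)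
  then show ?thesis
    by (simp add: lin_ext_superset[of ?A] lookup_add scale_left_distrib sum.distrib)
qed

lemma lin_ext_single [simp]: "lin_ext scale g (Poly_Mapping.single k z) = scale z (g k)"
  by (cases "z = 0") (simp_all add: lin_ext_def)

lemma lin_ext_fscale: "lin_ext scale g (fscale z p) = scale z (lin_ext scale g p)"
proof -
  have "Poly_Mapping.keys (fscale z p) \<subseteq> Poly_Mapping.keys p" by (auto simp: in_keys_iff)
  then show ?thesis
    by (simp add: lin_ext_superset[of "Poly_Mapping.keys p"] scale_sum_right)
qed

lemma linear_lin_ext: "Vector_Spaces.linear fscale scale (lin_ext scale g)"
  using vector_space_fscale V
  by (auto simp: Vector_Spaces.linear_iff lin_ext_add lin_ext_fscale)

end

section \<open>Evaluation homomorphisms of free algebras\<close>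

context complex_algebra
begin

lemma vs: "vector_space scale" by unfold_locales

lemma mult_scale_scale: "scale z a * scale z' b = scale (z * z') (a * b)"
  by (simp add: mult_scale_left mult_scale_right mult.commute)

text \<open>Both sides are bilinear in \<open>p\<close> and \<open>q\<close>, so it suffices to
  compare them on basis elements, where \<open>g\<close> is multiplicative. Applied to words and to
  exponent vectors.\<close>

lemma lin_ext_mult:
  assumes "\<And>k l :: 'k::monoid_add. g (k + l) = g k * g l"
  shows "lin_ext scale g (p * q) = lin_ext scale g p * lin_ext scale g q"
proof (induction p rule: poly_mapping_induct_single_add)
  case (single k a)
  show ?case
  proof (induction q rule: poly_mapping_induct_single_add)
    case (single l b)
    show ?case by (simp add: mult_single lin_ext_single[OF vs] assms mult_scale_scale)
  qed (simp add: lin_ext_add[OF vs] distrib_left)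
qed (simp add: lin_ext_add[OF vs] distrib_right)

lemma free_eval_eq_lin_ext: "free_eval scale \<gamma> = lin_ext scale (\<lambda>v. prod_list (map \<gamma> (letters v)))"
  by (simp add: fun_eq_iff free_eval_def lin_ext_def)

lemma free_eval_add: "free_eval scale \<gamma> (p + q) = free_eval scale \<gamma> p + free_eval scale \<gamma> q"
  by (simp add: free_eval_eq_lin_ext lin_ext_add[OF vs])

lemma free_eval_mult: "free_eval scale \<gamma> (p * q) = free_eval scale \<gamma> p * free_eval scale \<gamma> q"
  unfolding free_eval_eq_lin_ext by (rule lin_ext_mult) (simp add: plus_word_def)

lemma free_eval_single: "free_eval scale \<gamma> (Poly_Mapping.single 0 z) = scale z 1"
  by (simp add: free_eval_eq_lin_ext lin_ext_single[OF vs] zero_word_def)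

lemma free_eval_one: "free_eval scale \<gamma> 1 = 1"
  by (simp add: free_eval_single flip: single_one)

lemma free_eval_fgen: "free_eval scale \<gamma> (fgen g) = \<gamma> g"
  by (simp add: fgen_def free_eval_eq_lin_ext lin_ext_single[OF vs])

lemma free_eval_fscale: "free_eval scale \<gamma> (fscale z p) = scale z (free_eval scale \<gamma> p)"
  by (simp add: free_eval_eq_lin_ext lin_ext_fscale[OF vs])

end

text \<open>Scalars sit at the neutral element 0 of the monoid. Such elements are central even if
  the monoid is not commutative, as with words.\<close>

lemma complex_algebra_fscale:
  "complex_algebra (fscale :: complex \<Rightarrow> ('k::monoid_add \<Rightarrow>\<^sub>0 complex) \<Rightarrow> _)"
proof -
  have eq: "fscale z p = Poly_Mapping.single 0 z * p" for z and p :: "'k \<Rightarrow>\<^sub>0 complex"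
    by (simp add: fscale_def mult_map_scale_conv_mult)
  have central: "p * Poly_Mapping.single 0 z = Poly_Mapping.single 0 z * p"
    for z and p :: "'k \<Rightarrow>\<^sub>0 complex"
    by (induction p rule: poly_mapping_induct_single_add)
      (simp_all add: mult_single mult.commute distrib_left distrib_right)
  have "fscale z p * q = fscale z (p * q)" "p * fscale z q = fscale z (p * q)"
    for z and p q :: "'k \<Rightarrow>\<^sub>0 complex"
    using central[of p z] by (simp_all add: eq flip: mult.assoc)
  then show ?thesis
    using vector_space_fscale by (simp add: complex_algebra_def complex_algebra_axioms_def)
qed

lemma algebra_homI:
  assumes "complex_algebra scaleA" "complex_algebra scaleB"
    and "\<And>a b. h (a + b) = h a + h b" "\<And>z a. h (scaleA z a) = scaleB z (h a)"
    and "\<And>a b. h (a * b) = h a * h b" "h 1 = 1"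
  shows "algebra_hom scaleA scaleB h"
  using assms complex_algebra.vs[OF assms(1)] complex_algebra.vs[OF assms(2)]
  by (auto simp: algebra_hom_def algebra_hom_axioms_def Vector_Spaces.linear_iff)

lemma (in complex_algebra) algebra_hom_free_eval: "algebra_hom fscale scale (free_eval scale \<gamma>)"
  by (rule algebra_homI) (simp_all add: complex_algebra_fscale complex_algebra_axioms
      free_eval_add free_eval_fscale free_eval_mult free_eval_one)

lemma (in presented_algebra) relator_eq_0: "r \<in> R \<Longrightarrow> free_eval scale \<gamma> r = 0"
  using kernel generated_ideal.gen[of r R] by blast

text \<open>The universal property of the presentation. Two representatives of one element differ by
  an element of the ideal, and evaluation at \<open>\<Gamma>\<close> kills the ideal because it
  kills the relators.\<close>

lemma (in presented_algebra) lift_hom: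
  assumes L: "complex_algebra scaleL"
    and rel: "\<And>r. r \<in> R \<Longrightarrow> free_eval scaleL \<Gamma> r = 0"
  obtains \<Phi> where "algebra_hom scale scaleL \<Phi>" "\<And>g. \<Phi> (\<gamma> g) = \<Gamma> g"
proof -
  interpret L: complex_algebra scaleL by (fact L)
  interpret E: algebra_hom fscale scale "free_eval scale \<gamma>" by (rule algebra_hom_free_eval)
  interpret F: algebra_hom fscale scaleL "free_eval scaleL \<Gamma>" by (rule L.algebra_hom_free_eval)
  have ideal: "free_eval scaleL \<Gamma> p = 0" if "p \<in> generated_ideal R" for p
    using that by induction (simp_all add: rel F.add F.hom_mult)
  have eq: "free_eval scaleL \<Gamma> p = free_eval scaleL \<Gamma> q"
    if "free_eval scale \<gamma> p = free_eval scale \<gamma> q" for p q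
  proof -
    have "free_eval scale \<gamma> (p - q) = 0" using that by (simp add: E.diff)
    then have "free_eval scaleL \<Gamma> (p - q) = 0" using kernel ideal by blast
    then show ?thesis by (simp add: F.diff)
  qed
  \<comment> \<open>An arbitrary choice of representatives. Although \<open>s\<close> itself need
    not respect sums or products, \<open>eq\<close> makes the value at \<open>\<Gamma>\<close>
    independent of the choice.\<close>
  define s where "s a = (SOME p. free_eval scale \<gamma> p = a)" for a
  have s: "free_eval scale \<gamma> (s a) = a" for a
    using surjective unfolding s_def by (intro someI_ex[of "\<lambda>p. free_eval scale \<gamma> p = a"]) (metis UNIV_I imageE)
  show ?thesis
  proof
    show "algebra_hom scale scaleL (\<lambda>a. free_eval scaleL \<Gamma> (s a))"
    proof (rule algebra_homI)
      fix a b z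
      show "free_eval scaleL \<Gamma> (s (a + b)) = free_eval scaleL \<Gamma> (s a) + free_eval scaleL \<Gamma> (s b)"
        unfolding F.add[symmetric] by (rule eq) (simp add: s E.add)
      show "free_eval scaleL \<Gamma> (s (scale z a)) = scaleL z (free_eval scaleL \<Gamma> (s a))"
        unfolding F.scale[symmetric] by (rule eq) (simp add: s E.scale)
      show "free_eval scaleL \<Gamma> (s (a * b)) = free_eval scaleL \<Gamma> (s a) * free_eval scaleL \<Gamma> (s b)"
        unfolding F.hom_mult[symmetric] by (rule eq) (simp add: s E.hom_mult)
      show "free_eval scaleL \<Gamma> (s 1) = 1"
        unfolding F.hom_one[symmetric] by (rule eq) (simp add: s E.hom_one)
    qed (fact complex_algebra_axioms L.complex_algebra_axioms)+
    show "free_eval scaleL \<Gamma> (s (\<gamma> g)) = \<Gamma> g" for g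
      using eq[of "s (\<gamma> g)" "fgen g"] by (simp add: s free_eval_fgen L.free_eval_fgen)
  qed
qed

section \<open>Relators and their images under homomorphisms\<close>

lemma ball_setcompr:
  "(\<forall>r\<in>{r. \<exists>i. r = g i \<and> P i}. Q r) \<longleftrightarrow> (\<forall>i. P i \<longrightarrow> Q (g i))"
  by blast

lemma ball_setcompr2:
  "(\<forall>r\<in>{r. \<exists>i k. r = g i k \<and> P i k}. Q r) \<longleftrightarrow> (\<forall>i k. P i k \<longrightarrow> Q (g i k))"
  by blast

lemma ball_K_relators:
  "(\<forall>r\<in>K_relators c w. Q r) \<longleftrightarrow>
    (\<forall>i. Q (c i * c i - 1)) \<and> (\<forall>i j. i \<noteq> j \<longrightarrow> Q (c i * c j + c j * c i)) \<and> Q (w 1 - 1) \<and>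
    (\<forall>\<sigma> \<tau>. Q (w (\<sigma> * \<tau>) - w \<sigma> * w \<tau>)) \<and>
    (\<forall>\<sigma> i. Q (w \<sigma> * c i * w (inverse \<sigma>) - c (\<sigma> \<langle>$\<rangle> i)))"
  unfolding K_relators_def by (simp only: ball_Un ball_setcompr ball_setcompr2) simp

lemma ball_DAHCA_relators:
  "(\<forall>r\<in>DAHCA_relators u x y c w. Q r) \<longleftrightarrow>
    (\<forall>r\<in>K_relators c w. Q r) \<and>
    (\<forall>i j. Q (x i * x j - x j * x i)) \<and> (\<forall>i j. Q (y i * y j - y j * y i)) \<and>
    (\<forall>i j. Q (y i * c j - c j * y i)) \<and> (\<forall>i. Q (x i * c i + c i * x i)) \<and>
    (\<forall>i j. i \<noteq> j \<longrightarrow> Q (x i * c j - c j * x i)) \<and>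
    (\<forall>\<sigma> i. Q (w \<sigma> * x i * w (inverse \<sigma>) - x (\<sigma> \<langle>$\<rangle> i))) \<and>
    (\<forall>\<sigma> i. Q (w \<sigma> * y i * w (inverse \<sigma>) - y (\<sigma> \<langle>$\<rangle> i))) \<and>
    (\<forall>i j. i \<noteq> j \<longrightarrow> Q ((y j * x i - x i * y j) - u * (1 + c j * c i) * w \<langle>j \<leftrightarrow> i\<rangle>)) \<and>
    (\<forall>i. Q ((y i * x i - x i * y i) + u * (\<Sum>k\<in>-{i}. (1 + c k * c i) * w \<langle>k \<leftrightarrow> i\<rangle>)))"
  unfolding DAHCA_relators_def by (simp only: ball_Un ball_setcompr ball_setcompr2) simp

text \<open>A homomorphism sends a relator to the same expression in the images of the generators.
  With \<open>h\<close> an evaluation of the free algebra, this translates between formal relators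
  and equations in a concrete algebra.\<close>

lemma (in algebra_hom) hom_K_relators_eq_0_iff:
  "(\<forall>r\<in>K_relators c w. h r = 0) \<longleftrightarrow>
    (\<forall>r\<in>K_relators (\<lambda>i. h (c i)) (\<lambda>\<sigma>. h (w \<sigma>)). r = 0)"
  unfolding ball_K_relators by (simp only: add diff hom_mult hom_one)

lemma (in algebra_hom) hom_DAHCA_relators_eq_0_iff:
  "(\<forall>r\<in>DAHCA_relators u x y c w. h r = 0) \<longleftrightarrow>
    (\<forall>r\<in>DAHCA_relators (h u) (\<lambda>i. h (x i)) (\<lambda>i. h (y i)) (\<lambda>i. h (c i)) (\<lambda>\<sigma>. h (w \<sigma>)). r = 0)"
  unfolding ball_DAHCA_relators hom_K_relators_eq_0_iff
  by (simp only: add diff sum hom_mult hom_one)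

section \<open>Commuting Dunkl operators\<close>

text \<open>Inserting \<open>b * b'\<close> gives a' t = a' t b b' = a' a t b' = t b'. The
  commutation rules for the inverses \<open>p\<close> and \<open>q\<close> below all come from rules
  for the \<open>x i\<close> in this way.\<close>

lemma inverse_intertwines:
  fixes a :: "'a::ring_1"
  assumes "a' * a = 1" "b * b' = 1" "a * t = t * b"
  shows "a' * t = t * b'"
proof -
  have "a' * t = a' * (t * b) * b'" using assms(2) by (simp add: mult.assoc)
  also have "\<dots> = a' * a * (t * b')" unfolding assms(3)[symmetric] by (simp add: mult.assoc)
  finally show ?thesis using assms(1) by simp
qed

text \<open>Turns a product rule into one that applies inside right-nested products.\<close>

lemma assoc_rule: "a * b = d \<Longrightarrow> a * (b * t) = d * t" for a b d t :: "'a::semigroup_mult"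
  by (simp flip: mult.assoc)

locale clifford_perm_relations =
  fixes c :: "'n::finite \<Rightarrow> 'a::ring_1" and w :: "'n perm \<Rightarrow> 'a"
  assumes c_sq: "c i * c i = 1"
    and c_anti: "i \<noteq> j \<Longrightarrow> c i * c j = - (c j * c i)"
    and w_one: "w 1 = 1"
    and w_mult: "w (\<sigma> * \<tau>) = w \<sigma> * w \<tau>"
    and w_c: "w \<sigma> * c i = c (\<sigma> \<langle>$\<rangle> i) * w \<sigma>"
begin

lemma w_inverse: "w \<sigma> * w (inverse \<sigma>) = 1" "w (inverse \<sigma>) * w \<sigma> = 1"
  by (simp_all add: w_one flip: w_mult)

lemma w_conj: "w \<sigma> * a = b * w \<sigma> \<Longrightarrow> w \<sigma> * a * w (inverse \<sigma>) = b"
  by (simp add: w_inverse mult.assoc)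

end

lemma intertwines_of_conj:
  fixes a :: "'a::ring_1"
  assumes "g * a * g' - b = 0" "g' * g = 1"
  shows "g * a = b * g"
proof -
  have "b * g = g * a * (g' * g)" using assms(1) by (simp flip: mult.assoc)
  then show ?thesis using assms(2) by simp
qed

lemma clifford_perm_relationsI:
  assumes "\<forall>r\<in>K_relators c w. r = 0"
  shows "clifford_perm_relations c w"
proof -
  have rel: "c i * c i - 1 = 0" "i \<noteq> j \<Longrightarrow> c i * c j + c j * c i = 0" "w 1 - 1 = 0"
    "w (\<sigma> * \<tau>) - w \<sigma> * w \<tau> = 0" "w \<sigma> * c i * w (inverse \<sigma>) - c (\<sigma> \<langle>$\<rangle> i) = 0" for i j \<sigma> \<tau>
    using assms unfolding ball_K_relators by blast+
  have one: "w 1 = 1" and mult: "w (\<sigma> * \<tau>) = w \<sigma> * w \<tau>" for \<sigma> \<tau>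
    using rel(3,4) by (simp_all only: right_minus_eq)
  have inv: "w (inverse \<sigma>) * w \<sigma> = 1" for \<sigma> using one mult[of "inverse \<sigma>" \<sigma>] by simp
  show ?thesis
  proof
    show "w \<sigma> * c i = c (\<sigma> \<langle>$\<rangle> i) * w \<sigma>" for \<sigma> i
      by (rule intertwines_of_conj[OF rel(5) inv])
    show "i \<noteq> j \<Longrightarrow> c i * c j = - (c j * c i)" for i j
      unfolding eq_neg_iff_add_eq_0 by (rule rel(2))
    show "c i * c i = 1" for i using rel(1) by simp
  qed (fact one mult)+
qed

lemma (in clifford_perm_relations) K_relators_eq_0: "\<forall>r\<in>K_relators c w. r = 0"
  unfolding ball_K_relators eq_neg_iff_add_eq_0[symmetric] right_minus_eq
  using c_sq c_anti w_one w_mult w_conj[OF w_c] by blast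

locale clifford_poly_relations = clifford_perm_relations c w
  for c :: "'n::finite \<Rightarrow> 'a::ring_1" and w :: "'n perm \<Rightarrow> 'a" +
  fixes x :: "'n \<Rightarrow> 'a"
  assumes x_comm: "x i * x j = x j * x i"
    and x_c_same: "x i * c i = - (c i * x i)"
    and x_c: "i \<noteq> j \<Longrightarrow> x i * c j = c j * x i"
    and w_x: "w \<sigma> * x i = x (\<sigma> \<langle>$\<rangle> i) * w \<sigma>"

lemma DAHCA_relations:
  assumes "\<forall>r\<in>DAHCA_relators u x y c w. r = 0"
  shows "clifford_poly_relations c w x"
    and "i \<noteq> j \<Longrightarrow> y j * x i = x i * y j + u * (1 + c j * c i) * w \<langle>j \<leftrightarrow> i\<rangle>"
    and "y i * x i = x i * y i - u * (\<Sum>k\<in>-{i}. (1 + c k * c i) * w \<langle>k \<leftrightarrow> i\<rangle>)"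
proof -
  have K: "\<forall>r\<in>K_relators c w. r = 0"
    and rel: "x i * x j - x j * x i = 0" "x i * c i + c i * x i = 0"
      "i \<noteq> j \<Longrightarrow> x i * c j - c j * x i = 0" "w \<sigma> * x i * w (inverse \<sigma>) - x (\<sigma> \<langle>$\<rangle> i) = 0"
      "i \<noteq> j \<Longrightarrow> (y j * x i - x i * y j) - u * (1 + c j * c i) * w \<langle>j \<leftrightarrow> i\<rangle> = 0"
      "(y i * x i - x i * y i) + u * (\<Sum>k\<in>-{i}. (1 + c k * c i) * w \<langle>k \<leftrightarrow> i\<rangle>) = 0" for i j \<sigma>
    using assms unfolding ball_DAHCA_relators by blast+
  interpret clifford_perm_relations c w
    using K by (rule clifford_perm_relationsI)
  show "clifford_poly_relations c w x"
  proof
    show "w \<sigma> * x i = x (\<sigma> \<langle>$\<rangle> i) * w \<sigma>" for \<sigma> i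
      by (rule intertwines_of_conj[OF rel(4) w_inverse(2)])
    show "x i * c i = - (c i * x i)" for i
      unfolding eq_neg_iff_add_eq_0 by (rule rel(2))
  qed (use rel(1,3) in \<open>simp_all only: right_minus_eq not_False_eq_True\<close>)
  show "i \<noteq> j \<Longrightarrow> y j * x i = x i * y j + u * (1 + c j * c i) * w \<langle>j \<leftrightarrow> i\<rangle>"
    using rel(5)[of i j] by (simp add: algebra_simps)
  show "y i * x i = x i * y i - u * (\<Sum>k\<in>-{i}. (1 + c k * c i) * w \<langle>k \<leftrightarrow> i\<rangle>)"
    using rel(6)[of i] by (simp add: algebra_simps eq_neg_iff_add_eq_0)
qed

section \<open>Inverses of \<open>x i - x j\<close> and \<open>x i + x j\<close> and their
  commutation rules\<close>

locale clifford_poly_inverses = clifford_poly_relations c w x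
  for c :: "'n::finite \<Rightarrow> 'a::ring_1" and w :: "'n perm \<Rightarrow> 'a" and x +
  fixes p q :: "'n \<Rightarrow> 'n \<Rightarrow> 'a"
  assumes p_left: "i \<noteq> j \<Longrightarrow> p i j * (x i - x j) = 1"
    and p_right: "i \<noteq> j \<Longrightarrow> (x i - x j) * p i j = 1"
    and q_left: "i \<noteq> j \<Longrightarrow> q i j * (x i + x j) = 1"
    and q_right: "i \<noteq> j \<Longrightarrow> (x i + x j) * q i j = 1"
begin

lemma c_sq': "c i * (c i * t) = t"
  by (simp add: c_sq flip: mult.assoc)

lemma p_x: "i \<noteq> j \<Longrightarrow> p i j * x k = x k * p i j"
  by (rule inverse_intertwines[OF p_left p_right]) (auto simp: algebra_simps x_comm)

lemma q_x: "i \<noteq> j \<Longrightarrow> q i j * x k = x k * q i j"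
  by (rule inverse_intertwines[OF q_left q_right]) (auto simp: algebra_simps x_comm)

lemma p_p: "i \<noteq> j \<Longrightarrow> k \<noteq> l \<Longrightarrow> p i j * p k l = p k l * p i j"
  by (rule inverse_intertwines[OF p_left p_right]) (auto simp: algebra_simps p_x)

lemma p_q: "i \<noteq> j \<Longrightarrow> k \<noteq> l \<Longrightarrow> p i j * q k l = q k l * p i j"
  by (rule inverse_intertwines[OF p_left p_right]) (auto simp: algebra_simps q_x)

lemma q_q: "i \<noteq> j \<Longrightarrow> k \<noteq> l \<Longrightarrow> q i j * q k l = q k l * q i j"
  by (rule inverse_intertwines[OF q_left q_right]) (auto simp: algebra_simps q_x)

lemma p_flip: assumes "i \<noteq> j" shows "p j i = - p i j"
proof -
  have "p j i = p j i * ((x i - x j) * p i j)" using assms by (simp add: p_right)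
  also have "\<dots> = - (p j i * (x j - x i)) * p i j" by (simp add: algebra_simps)
  finally show ?thesis using assms by (simp add: p_left)
qed

lemma q_flip: assumes "i \<noteq> j" shows "q j i = q i j"
proof -
  have "q j i = q j i * ((x i + x j) * q i j)" using assms by (simp add: q_right)
  also have "\<dots> = (q j i * (x j + x i)) * q i j" by (simp add: algebra_simps)
  finally show ?thesis using assms by (simp add: q_left)
qed

text \<open>Moving \<open>c i\<close> across changes the sign of \<open>x i\<close> and fixes
  \<open>x j\<close>, so it exchanges \<open>x i - x j\<close> and \<open>x i + x j\<close> up to
  sign, and hence their inverses. For \<open>c j\<close> in the second position the exchange is
  without sign.\<close>

lemma c_p_fst: "i \<noteq> j \<Longrightarrow> c i * p i j = - (q i j * c i)"
  using inverse_intertwines[of "q i j" "x i + x j" "x j - x i" "- p i j" "c i"]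
    q_left[of i j] p_right[of i j]
  by (simp add: algebra_simps x_c_same x_c)

lemma c_q_fst: "i \<noteq> j \<Longrightarrow> c i * q i j = - (p i j * c i)"
  using inverse_intertwines[of "p i j" "x i - x j" "- x i - x j" "- q i j" "c i"]
    p_left[of i j] q_right[of i j]
  by (simp add: algebra_simps x_c_same x_c)

lemma c_p_snd: "i \<noteq> j \<Longrightarrow> c j * p i j = q i j * c j"
  using inverse_intertwines[of "q i j" "x i + x j" "x i - x j" "p i j" "c j"]
    q_left[of i j] p_right[of i j]
  by (simp add: algebra_simps x_c_same x_c)

lemma c_q_snd: "i \<noteq> j \<Longrightarrow> c j * q i j = p i j * c j"
  using inverse_intertwines[of "p i j" "x i - x j" "x i + x j" "q i j" "c j"]
    p_left[of i j] q_right[of i j]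
  by (simp add: algebra_simps x_c_same x_c)

lemma c_p_other: "i \<noteq> j \<Longrightarrow> k \<noteq> i \<Longrightarrow> k \<noteq> j \<Longrightarrow> c k * p i j = p i j * c k"
  by (rule inverse_intertwines[OF p_left p_right, symmetric]) (auto simp: algebra_simps x_c)

lemma c_q_other: "i \<noteq> j \<Longrightarrow> k \<noteq> i \<Longrightarrow> k \<noteq> j \<Longrightarrow> c k * q i j = q i j * c k"
  by (rule inverse_intertwines[OF q_left q_right, symmetric]) (auto simp: algebra_simps x_c)

lemmas c_pq = c_p_fst c_q_fst c_p_snd c_q_snd c_p_other c_q_other

lemma w_p: "i \<noteq> j \<Longrightarrow> w \<sigma> * p i j = p (\<sigma> \<langle>$\<rangle> i) (\<sigma> \<langle>$\<rangle> j) * w \<sigma>"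
  by (rule inverse_intertwines[OF p_left p_right, symmetric]) (auto simp: algebra_simps w_x apply_inj)

lemma w_q: "i \<noteq> j \<Longrightarrow> w \<sigma> * q i j = q (\<sigma> \<langle>$\<rangle> i) (\<sigma> \<langle>$\<rangle> j) * w \<sigma>"
  by (rule inverse_intertwines[OF q_left q_right, symmetric]) (auto simp: algebra_simps w_x apply_inj)

lemmas c_pq_assoc = c_pq[THEN assoc_rule]

text \<open>The coefficient 1/(x_i - x_j) + 1/(x_i + x_j) c_j c_i of a transposition in the Dunkl
  operator, treated as a solution of the associative Yang-Baxter equation.\<close>

definition R :: "'n \<Rightarrow> 'n \<Rightarrow> 'a" where
  "R i j = p i j + q i j * c j * c i"

lemma R_flip: "i \<noteq> j \<Longrightarrow> R j i = - R i j"
  using c_anti[of i j] by (simp add: R_def p_flip[of i j] q_flip[of i j] mult.assoc)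

lemma w_R: "i \<noteq> j \<Longrightarrow> w \<sigma> * R i j = R (\<sigma> \<langle>$\<rangle> i) (\<sigma> \<langle>$\<rangle> j) * w \<sigma>"
proof -
  assume "i \<noteq> j"
  have "w \<sigma> * (q i j * c j * c i) = q (\<sigma> \<langle>$\<rangle> i) (\<sigma> \<langle>$\<rangle> j) * (w \<sigma> * c j) * c i"
    using w_q[OF \<open>i \<noteq> j\<close>] by (simp flip: mult.assoc)
  also have "\<dots> = q (\<sigma> \<langle>$\<rangle> i) (\<sigma> \<langle>$\<rangle> j) * c (\<sigma> \<langle>$\<rangle> j) * c (\<sigma> \<langle>$\<rangle> i) * w \<sigma>"
    by (simp add: w_c mult.assoc)
  finally show ?thesis using w_p[OF \<open>i \<noteq> j\<close>] by (simp add: R_def algebra_simps)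
qed

text \<open>A noncommutative form of 1/(ab) = 1/(a + b) (1/a + 1/b), obtained by inserting
  \<open>d' * d\<close> in front. The order of factors on the right matches the Yang-Baxter
  equation.\<close>

lemma partial_fractions:
  fixes a b d a' b' d' :: 'a
  assumes "a + b = d" "d' * d = 1" "a * a' = 1" "b * b' = 1"
    and "a' * b' = b' * a'" "d' * b' = b' * d'"
  shows "a' * b' = d' * a' + b' * d'"
proof -
  have "a' * b' = d' * (a + b) * (a' * b')" using assms by simp
  also have "\<dots> = d' * ((a * a') * b') + d' * ((b * b') * a')"
    using assms(5) by (simp add: algebra_simps)
  finally show ?thesis using assms by simp
qed

text \<open>With all Clifford generators moved to the right, both sides are combinations of 1,
  \<open>c j * c i\<close>, \<open>c k * c j\<close> and \<open>c k * c i\<close>. Comparing the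
  four coefficients leaves four partial fraction identities, which are facts 1 to 4.\<close>

lemma associative_Yang_Baxter:
  assumes d: "i \<noteq> j" "j \<noteq> k" "i \<noteq> k"
  shows "R i j * R j k = R i k * R i j + R j k * R i k"
proof -
  note d' = d d[symmetric]
  have 1: "p i j * p j k = p i k * p i j + p j k * p i k"
    using d' p_left p_right p_p by (intro partial_fractions[of "x i - x j" "x j - x k"]) auto
  \<comment> \<open>Negating the second denominator makes the sum telescope: (x_i + x_j) + (- x_j -
    x_k) = x_i - x_k. Fact 3 uses \<open>x k - x j\<close> for the same purpose.\<close>
  have 2: "q i j * - q j k = p i k * q i j + - q j k * p i k"
    using d' p_left[of i k] q_right[of i j] q_right[of j k] p_q[of i k j k] q_q[of i j j k]
    by (intro partial_fractions[of "x i + x j" "- x j - x k" "x i - x k"]) (simp_all add: algebra_simps)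
  have 3: "q i j * - p j k = q i k * q i j + - p j k * q i k"
    using d' q_left[of i k] q_right[of i j] p_right[of j k] p_q[of j k i k] p_q[of j k i j]
    by (intro partial_fractions[of "x i + x j" "x k - x j" "x i + x k"]) (simp_all add: algebra_simps)
  have 4: "p i j * q j k = q i k * p i j + q j k * q i k"
    using d' q_left p_right q_right p_q q_q by (intro partial_fractions[of "x i - x j" "x j + x k"]) (auto simp: algebra_simps)
  note c_anti' = c_anti[of i j] c_anti[of i k] c_anti[of j k]
  note normalize = R_def algebra_simps c_pq c_pq_assoc c_anti' c_anti'[THEN assoc_rule] c_sq c_sq'
  have "R i j * R j k = p i j * p j k - q i j * q j k * c j * c i + p i j * q j k * c k * c j
     + q i j * p j k * c k * c i"
    using d' by (simp add: normalize)
  moreover have "R i k * R i j = p i k * p i j + p i k * q i j * c j * c i - q i k * q i j * c k * c i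
     + q i k * p i j * c k * c j"
    using d' by (simp add: normalize)
  moreover have "R j k * R i k = p j k * p i k + p j k * q i k * c k * c i + q j k * q i k * c k * c j
     - q j k * p i k * c j * c i"
    using d' by (simp add: normalize)
  moreover have 2: "q i j * q j k = q j k * p i k - p i k * q i j"
    using 2 by (simp add: algebra_simps)
  moreover have 3: "q i j * p j k = p j k * q i k - q i k * q i j"
    using 3 by (simp add: algebra_simps)
  ultimately show ?thesis using 1 4 by (simp add: distrib_right left_diff_distrib)
qed

section \<open>The operators \<open>D i\<close> and their relations\<close>

definition T :: "'n \<Rightarrow> 'n \<Rightarrow> 'a" where
  "T i k = R i k * w \<langle>k \<leftrightarrow> i\<rangle>"

lemma T_flip: "i \<noteq> k \<Longrightarrow> T k i = - T i k"
  by (simp add: T_def R_flip[of i k] swap_sym)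

lemma swap_conj: "\<sigma> * \<langle>k \<leftrightarrow> i\<rangle> = \<langle>\<sigma> \<langle>$\<rangle> k \<leftrightarrow> \<sigma> \<langle>$\<rangle> i\<rangle> * \<sigma>" for \<sigma> :: "'n perm"
proof (rule perm_eqI)
  fix a
  show "(\<sigma> * \<langle>k \<leftrightarrow> i\<rangle>) \<langle>$\<rangle> a = (\<langle>\<sigma> \<langle>$\<rangle> k \<leftrightarrow> \<sigma> \<langle>$\<rangle> i\<rangle> * \<sigma>) \<langle>$\<rangle> a"
    by (cases "a = k"; cases "a = i") (simp_all add: apply_times apply_inj)
qed

lemma w_T: assumes "i \<noteq> k" shows "w \<sigma> * T i k = T (\<sigma> \<langle>$\<rangle> i) (\<sigma> \<langle>$\<rangle> k) * w \<sigma>"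
proof -
  have "w \<sigma> * T i k = R (\<sigma> \<langle>$\<rangle> i) (\<sigma> \<langle>$\<rangle> k) * w (\<sigma> * \<langle>k \<leftrightarrow> i\<rangle>)"
    using w_R[OF assms] by (simp add: T_def w_mult flip: mult.assoc)
  then show ?thesis by (simp add: swap_conj w_mult T_def mult.assoc)
qed

lemma T_mult_T:
  assumes "k \<noteq> l"
  shows "T i j * T k l = R i j * R (\<langle>j \<leftrightarrow> i\<rangle> \<langle>$\<rangle> k) (\<langle>j \<leftrightarrow> i\<rangle> \<langle>$\<rangle> l) * w (\<langle>j \<leftrightarrow> i\<rangle> * \<langle>l \<leftrightarrow> k\<rangle>)"
  using w_R[OF assms, of "\<langle>j \<leftrightarrow> i\<rangle>", THEN assoc_rule] by (simp add: T_def w_mult mult.assoc)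

lemma commute_mult: "a * t = t * a \<Longrightarrow> b * t = t * b \<Longrightarrow> a * b * t = t * (a * b)"
  for a b t :: 'a
  by (metis mult.assoc)

text \<open>\<open>R i j\<close> is even in the Clifford generators: exchanging the pair
  \<open>c j * c i\<close> with a generator of another index produces two signs, which
  cancel.\<close>

lemma R_commute_disjoint:
  assumes "distinct [i, j, k, l]"
  shows "R i j * R k l = R k l * R i j"
proof -
  have c: "c j * c i * c m = c m * (c j * c i)" if "m = k \<or> m = l" for m
    using assms that c_anti[of i m] c_anti[of j m] c_anti[of j m, THEN assoc_rule]
    by (auto simp: mult.assoc)
  have "a * R k l = R k l * a" if "a * p k l = p k l * a" "a * q k l = q k l * a"
    "a * c k = c k * a" "a * c l = c l * a" for a
    using commute_mult[of "q k l" a "c l * c k"] commute_mult[of "c l" a "c k"] that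
    by (simp add: R_def algebra_simps)
  moreover have "c j * c i * p k l = p k l * (c j * c i)" "c j * c i * q k l = q k l * (c j * c i)"
    using assms by (auto intro!: commute_mult simp: c_pq)
  ultimately have "c j * c i * R k l = R k l * (c j * c i)" "p i j * R k l = R k l * p i j"
    "q i j * R k l = R k l * q i j"
    using assms c by (auto simp: c_pq p_p p_q q_q)
  then show ?thesis
    using commute_mult[of "q i j" "R k l" "c j * c i"] by (simp add: R_def[of i j] algebra_simps)
qed

lemma T_commute_disjoint:
  assumes "distinct [i, j, k, l]"
  shows "T i j * T k l = T k l * T i j"
proof -
  have "\<langle>j \<leftrightarrow> i\<rangle> * \<langle>l \<leftrightarrow> k\<rangle> = \<langle>l \<leftrightarrow> k\<rangle> * \<langle>j \<leftrightarrow> i\<rangle>"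
    using assms by (intro perm_mult_commute) (auto simp: affected_swap)
  moreover have "\<langle>j \<leftrightarrow> i\<rangle> \<langle>$\<rangle> k = k" "\<langle>j \<leftrightarrow> i\<rangle> \<langle>$\<rangle> l = l" "\<langle>l \<leftrightarrow> k\<rangle> \<langle>$\<rangle> i = i" "\<langle>l \<leftrightarrow> k\<rangle> \<langle>$\<rangle> j = j"
    using assms by auto
  ultimately show ?thesis
    using assms R_commute_disjoint[OF assms] by (simp add: T_mult_T)
qed

text \<open>Every product here has as its permutation one of the two 3-cycles \<open>\<rho>\<close>
  and \<open>\<rho>'\<close>. The coefficient of \<open>w \<rho>\<close> vanishes by the Yang-Baxter
  equation for i, j, k, and that of \<open>w \<rho>'\<close> by the equation for k, j, i.\<close>

lemma T_triangle:
  assumes d: "i \<noteq> j" "j \<noteq> k" "i \<noteq> k"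
  shows "T i k * T j k - T j k * T i k + (T i j * T j k - T j k * T i j)
    + (T i k * T j i - T j i * T i k) = 0"
proof -
  define \<rho> \<rho>' where "\<rho> = \<langle>k \<leftrightarrow> i\<rangle> * \<langle>k \<leftrightarrow> j\<rangle>" and "\<rho>' = \<langle>k \<leftrightarrow> j\<rangle> * \<langle>k \<leftrightarrow> i\<rangle>"
  have perms: "\<langle>j \<leftrightarrow> i\<rangle> * \<langle>k \<leftrightarrow> j\<rangle> = \<rho>'" "\<langle>k \<leftrightarrow> j\<rangle> * \<langle>j \<leftrightarrow> i\<rangle> = \<rho>" "\<langle>k \<leftrightarrow> i\<rangle> * \<langle>i \<leftrightarrow> j\<rangle> = \<rho>'"
    "\<langle>i \<leftrightarrow> j\<rangle> * \<langle>k \<leftrightarrow> i\<rangle> = \<rho>"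
    unfolding \<rho>_def \<rho>'_def
    using d swap_conj[of "\<langle>k \<leftrightarrow> j\<rangle>" j i] swap_conj[of "\<langle>j \<leftrightarrow> i\<rangle>" k j] swap_conj[of "\<langle>k \<leftrightarrow> i\<rangle>" i j]
      swap_conj[of "\<langle>k \<leftrightarrow> j\<rangle>" k i] swap_conj[of "\<langle>i \<leftrightarrow> j\<rangle>" k i] swap_conj[of "\<langle>k \<leftrightarrow> i\<rangle>" k j]
    by (simp_all add: swap_sym)
  note d' = d d[symmetric]
  have products: "T i k * T j k = - (R i k * R i j * w \<rho>)" "T j k * T i k = - (R j k * R i j) * - w \<rho>'"
    "T i j * T j k = R i j * R i k * w \<rho>'" "T j k * T i j = R j k * R i k * w \<rho>"
    "T i k * T j i = R i k * R j k * w \<rho>'" "T j i * T i k = - (R i j * R j k * w \<rho>)"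
    using d' by (simp_all add: T_mult_T perms \<rho>_def[symmetric] \<rho>'_def[symmetric] R_flip[of i j])
  have YB: "R i j * R j k = R i k * R i j + R j k * R i k"
    using associative_Yang_Baxter d by blast
  have YB': "R j k * R i j = R i k * R j k + R i j * R i k"
    using associative_Yang_Baxter[of k j i] d'
    by (simp add: R_flip[of i j] R_flip[of j k] R_flip[of i k])
  show ?thesis unfolding products by (simp add: YB YB' distrib_right left_diff_distrib)
qed

definition D :: "'n \<Rightarrow> 'a" where
  "D i = (\<Sum>k\<in>-{i}. T i k)"

lemma w_D: "w \<sigma> * D i = D (\<sigma> \<langle>$\<rangle> i) * w \<sigma>"
proof -
  have "w \<sigma> * D i = (\<Sum>k\<in>-{i}. T (\<sigma> \<langle>$\<rangle> i) (\<sigma> \<langle>$\<rangle> k)) * w \<sigma>"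
    by (simp add: D_def sum_distrib_left sum_distrib_right w_T)
  also have "(\<Sum>k\<in>-{i}. T (\<sigma> \<langle>$\<rangle> i) (\<sigma> \<langle>$\<rangle> k)) = D (\<sigma> \<langle>$\<rangle> i)"
    unfolding D_def
    by (rule sum.reindex_bij_betw, rule bij_betw_byWitness[where f' = "apply (inverse \<sigma>)"])
      (auto simp: apply_sequence[of "inverse \<sigma>"] apply_sequence[of \<sigma> "inverse \<sigma>"] apply_inj)
  finally show ?thesis .
qed

text \<open>Already each \<open>T i k\<close> commutes with every \<open>c j\<close>. For j equal to
  i or k, the swap exchanges \<open>c i\<close> and \<open>c k\<close>, while passage through
  \<open>R i k\<close> matches its \<open>p\<close> summand with its \<open>q\<close> summand; the
  two effects agree.\<close>

lemma D_c: "D i * c j = c j * D i"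
proof -
  have "T i k * c j = c j * T i k" if "i \<noteq> k" for k
  proof -
    have "T i k * c j = R i k * c (\<langle>k \<leftrightarrow> i\<rangle> \<langle>$\<rangle> j) * w \<langle>k \<leftrightarrow> i\<rangle>"
      by (simp add: T_def w_c mult.assoc)
    also have "R i k * c (\<langle>k \<leftrightarrow> i\<rangle> \<langle>$\<rangle> j) = c j * R i k"
      using that c_anti[of j i] c_anti[of j k] c_anti[of k i]
        c_anti[of j i, THEN assoc_rule] c_anti[of j k, THEN assoc_rule] c_anti[of k i, THEN assoc_rule]
      by (cases "j = i"; cases "j = k")
        (simp_all add: R_def algebra_simps c_pq c_pq_assoc c_sq c_sq')
    finally show ?thesis by (simp add: T_def mult.assoc)
  qed
  then show ?thesis by (simp add: D_def sum_distrib_left sum_distrib_right)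
qed

text \<open>\<open>R i j\<close> intertwines \<open>x i\<close> and \<open>x j\<close> up to an
  error in which \<open>p i j\<close> meets \<open>x i - x j\<close> and \<open>q i j\<close> meets
  \<open>x i + x j\<close>. The denominators cancel, which is why the commutators of
  \<open>D\<close> with \<open>x\<close> have no fractions.\<close>

lemma R_x:
  assumes "i \<noteq> j"
  shows "R i j * x i - x j * R i j = 1 - c j * c i"
    and "R i j * x j - x i * R i j = - (1 + c j * c i)"
    and "k \<noteq> i \<Longrightarrow> k \<noteq> j \<Longrightarrow> R i j * x k = x k * R i j"
proof -
  have R_x: "R i j * x l = p i j * x l + q i j * (c j * c i * x l)" for l
    by (simp add: R_def algebra_simps)
  have x_R: "x l * R i j = p i j * x l + q i j * x l * (c j * c i)" for l
    using p_x[OF assms, of l] q_x[OF assms, of l, THEN assoc_rule] by (simp add: R_def algebra_simps)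
  have cc: "c j * c i * x i = - (x i * (c j * c i))" "c j * c i * x j = - (x j * (c j * c i))"
    using assms x_c[of i j] x_c[of j i] x_c_same[of i] x_c_same[of j]
      x_c[of i j, THEN assoc_rule] x_c_same[of j, THEN assoc_rule]
    by (simp_all add: mult.assoc)
  have "R i j * x i - x j * R i j = p i j * (x i - x j) - q i j * (x i + x j) * (c j * c i)"
    unfolding R_x x_R cc by (simp add: algebra_simps)
  then show "R i j * x i - x j * R i j = 1 - c j * c i"
    using assms by (simp add: p_left q_left)
  have "R i j * x j - x i * R i j = - (p i j * (x i - x j)) - q i j * (x i + x j) * (c j * c i)"
    unfolding R_x x_R cc by (simp add: algebra_simps)
  then show "R i j * x j - x i * R i j = - (1 + c j * c i)"
    using assms by (simp add: p_left q_left)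
  assume "k \<noteq> i" "k \<noteq> j"
  then have "c j * c i * x k = x k * (c j * c i)"
    by (intro commute_mult) (simp_all add: x_c)
  then show "R i j * x k = x k * R i j"
    unfolding R_x x_R by (simp add: mult.assoc)
qed

lemma T_x:
  "T i j * x k - x l * T i j = (R i j * x (\<langle>j \<leftrightarrow> i\<rangle> \<langle>$\<rangle> k) - x l * R i j) * w \<langle>j \<leftrightarrow> i\<rangle>"
  by (simp add: T_def w_x algebra_simps)

lemma D_x:
  assumes "i \<noteq> j"
  shows "D j * x i - x i * D j = (1 + c j * c i) * w \<langle>j \<leftrightarrow> i\<rangle>"
proof -
  have "D j = T j i + (\<Sum>k\<in>-{j} - {i}. T j k)"
    unfolding D_def using assms by (intro sum.remove) auto
  then have "D j * x i - x i * D j = (T j i * x i - x i * T j i) +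
      (\<Sum>k\<in>-{j} - {i}. T j k * x i - x i * T j k)"
    by (simp add: sum_distrib_left sum_distrib_right sum_subtractf algebra_simps)
  \<comment> \<open>The swap of j and k fixes i, and \<open>R j k\<close> commutes with
    \<open>x i\<close>, so only the summand at i contributes to the commutator.\<close>
  also have "(\<Sum>k\<in>-{j} - {i}. T j k * x i - x i * T j k) = 0"
  proof (intro sum.neutral ballI)
    fix k assume "k \<in> -{j} - {i}"
    then show "T j k * x i - x i * T j k = 0"
      using assms R_x(3)[of j k i] unfolding T_x by auto
  qed
  finally show ?thesis
    using assms R_x(1)[of j i] c_anti[of i j] unfolding T_x by (simp add: swap_sym)
qed

lemma D_x_same: "D i * x i - x i * D i = - (\<Sum>k\<in>-{i}. (1 + c k * c i) * w \<langle>k \<leftrightarrow> i\<rangle>)"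
proof -
  have "D i * x i - x i * D i = (\<Sum>k\<in>-{i}. T i k * x i - x i * T i k)"
    by (simp add: D_def sum_distrib_left sum_distrib_right sum_subtractf)
  also have "\<dots> = (\<Sum>k\<in>-{i}. - ((1 + c k * c i) * w \<langle>k \<leftrightarrow> i\<rangle>))"
  proof (intro sum.cong refl)
    fix k assume "k \<in> -{i}"
    then have "i \<noteq> k" by auto
    show "T i k * x i - x i * T i k = - ((1 + c k * c i) * w \<langle>k \<leftrightarrow> i\<rangle>)"
      by (simp only: T_x apply_swap_simp R_x(2)[OF \<open>i \<noteq> k\<close>] mult_minus_left)
  qed
  finally show ?thesis by (simp add: sum_negf)
qed

text \<open>After splitting off \<open>T i j\<close> and \<open>T j i\<close>, which commute as
  negatives of each other, the commutator is a sum over third indices k of the expressions in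
  \<open>T_triangle\<close>.\<close>

lemma D_D: "D i * D j = D j * D i"
proof (cases "i = j")
  case False
  define K where "K = - {i} - {j}"
  have K: "K = - {j} - {i}" "finite K" by (auto simp: K_def)
  have Di: "D i = T i j + (\<Sum>k\<in>K. T i k)"
    unfolding D_def K_def using False by (intro sum.remove) auto
  have Dj: "D j = T j i + (\<Sum>l\<in>K. T j l)"
    unfolding D_def K(1) using False by (intro sum.remove) auto
  \<comment> \<open>For k different from l the two swaps have disjoint indices and the terms
    commute, so only the diagonal survives.\<close>
  have "(\<Sum>k\<in>K. \<Sum>l\<in>K. T i k * T j l - T j l * T i k)
      = (\<Sum>k\<in>K. \<Sum>l\<in>K. if l = k then T i k * T j k - T j k * T i k else 0)"
    using False T_commute_disjoint[of i _ j] by (intro sum.cong refl) (auto simp: K_def)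
  also have "\<dots> = (\<Sum>k\<in>K. T i k * T j k - T j k * T i k)"
    using K(2) by (simp add: sum.delta)
  finally have diag: "(\<Sum>k\<in>K. \<Sum>l\<in>K. T i k * T j l - T j l * T i k) =
    (\<Sum>k\<in>K. T i k * T j k - T j k * T i k)" .
  have "D i * D j - D j * D i = (T i j * T j i - T j i * T i j)
      + (\<Sum>k\<in>K. T i j * T j k - T j k * T i j) + (\<Sum>k\<in>K. T i k * T j i - T j i * T i k)
      + (\<Sum>k\<in>K. \<Sum>l\<in>K. T i k * T j l - T j l * T i k)"
    unfolding Di Dj
    using sum.swap[of "\<lambda>k l. T i l * T j k" K K]
    by (simp add: distrib_left distrib_right sum_distrib_left sum_distrib_right sum_subtractf
        sum.distrib)
  also have "\<dots> = (\<Sum>k\<in>K. T i k * T j k - T j k * T i k + (T i j * T j k - T j k * T i j)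
      + (T i k * T j i - T j i * T i k))"
    unfolding diag using False by (simp add: T_flip[of i j] sum.distrib)
  also have "\<dots> = 0"
    using False by (intro sum.neutral ballI T_triangle) (auto simp: K_def)
  finally show ?thesis by simp
qed simp

text \<open>A central factor \<open>u\<close> preserves the commutation rules of \<open>D\<close>
  and multiplies its commutators with \<open>x\<close>, so the rules for \<open>D\<close> yield the
  relations with parameter \<open>u\<close>.\<close>

lemma DAHCA_relators_eq_0:
  assumes u: "\<And>a. u * a = a * u"
  shows "\<forall>r\<in>DAHCA_relators u x (\<lambda>i. u * D i) c w. r = 0"
proof -
  have "u * D i * c j = c j * (u * D i)" for i j
    by (metis mult.assoc u D_c)
  moreover have "w \<sigma> * (u * D i) * w (inverse \<sigma>) = u * D (\<sigma> \<langle>$\<rangle> i)" for \<sigma> i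
    by (rule w_conj) (metis mult.assoc u w_D)
  moreover have "u * D i * (u * D j) = u * D j * (u * D i)" for i j
    by (metis mult.assoc u D_D)
  moreover have ux: "u * D j * x i - x i * (u * D j) = u * (D j * x i - x i * D j)" for i j
    by (metis mult.assoc right_diff_distrib u)
  have "u * D j * x i - x i * (u * D j) = u * (1 + c j * c i) * w \<langle>j \<leftrightarrow> i\<rangle>" if "i \<noteq> j" for i j
    unfolding ux D_x[OF that] by (simp only: mult.assoc)
  moreover have "u * D i * x i - x i * (u * D i) =
      - (u * (\<Sum>k\<in>-{i}. (1 + c k * c i) * w \<langle>k \<leftrightarrow> i\<rangle>))" for i
    by (simp add: ux D_x_same)
  ultimately show ?thesis
    unfolding ball_DAHCA_relators eq_neg_iff_add_eq_0[symmetric] right_minus_eq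
    using K_relators_eq_0 x_comm x_c x_c_same w_conj[OF w_x] by blast
qed

end

section \<open>The representation on a regular orbit\<close>

datatype ('b, 'k) sqmat = Mat (entry: "'b \<Rightarrow> 'b \<Rightarrow> 'k")

lemma sqmat_eqI: "(\<And>a b. entry A a b = entry B a b) \<Longrightarrow> A = B"
  by (cases A; cases B) (auto simp: fun_eq_iff)

instantiation sqmat :: (finite, ring_1) ring_1
begin

definition zero_sqmat :: "('a, 'b) sqmat" where "0 = Mat (\<lambda>a b. 0)"
definition one_sqmat :: "('a, 'b) sqmat" where "1 = Mat (\<lambda>a b. if b = a then 1 else 0)"
definition plus_sqmat :: "('a, 'b) sqmat \<Rightarrow> ('a, 'b) sqmat \<Rightarrow> ('a, 'b) sqmat"
  where "A + B = Mat (\<lambda>a b. entry A a b + entry B a b)"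
definition minus_sqmat :: "('a, 'b) sqmat \<Rightarrow> ('a, 'b) sqmat \<Rightarrow> ('a, 'b) sqmat"
  where "A - B = Mat (\<lambda>a b. entry A a b - entry B a b)"
definition uminus_sqmat :: "('a, 'b) sqmat \<Rightarrow> ('a, 'b) sqmat"
  where "- A = Mat (\<lambda>a b. - entry A a b)"
definition times_sqmat :: "('a, 'b) sqmat \<Rightarrow> ('a, 'b) sqmat \<Rightarrow> ('a, 'b) sqmat"
  where "A * B = Mat (\<lambda>a b. \<Sum>d\<in>UNIV. entry A a d * entry B d b)"

instance
proof
  fix A B C :: "('a, 'b) sqmat"
  have "(\<Sum>d\<in>UNIV. (\<Sum>e\<in>UNIV. entry A a e * entry B e d) * entry C d b)
      = (\<Sum>e\<in>UNIV. entry A a e * (\<Sum>d\<in>UNIV. entry B e d * entry C d b))" for a b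
    unfolding sum_distrib_left sum_distrib_right mult.assoc by (rule sum.swap)
  then show "A * B * C = A * (B * C)"
    by (simp add: times_sqmat_def)
  have delta: "(if b = a then 1 else 0) * z = (if b = a then z else 0)"
    "z * (if b = a then 1 else 0) = (if b = a then z else 0)" for a b :: 'a and z :: 'b by auto
  show "1 * A = A" "A * 1 = A"
    by (rule sqmat_eqI; simp add: times_sqmat_def one_sqmat_def delta)+
  show "(0 :: ('a, 'b) sqmat) \<noteq> 1"
    by (auto simp: zero_sqmat_def one_sqmat_def fun_eq_iff)
qed (auto intro!: sqmat_eqI simp: zero_sqmat_def plus_sqmat_def minus_sqmat_def uminus_sqmat_def
    times_sqmat_def algebra_simps sum.distrib)

end

lemma entry_simps [simp]:
  "entry 0 a b = 0" "entry (A + B) a b = entry A a b + entry B a b"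
  by (simp_all add: zero_sqmat_def plus_sqmat_def)

lemma entry_sum: "entry (sum F I) a b = (\<Sum>i\<in>I. entry (F i) a b)"
  by (induction I rule: infinite_finite_induct) simp_all

definition mat_scale :: "(complex \<Rightarrow> 'k \<Rightarrow> 'k) \<Rightarrow> complex \<Rightarrow> ('b, 'k) sqmat \<Rightarrow> ('b, 'k) sqmat"
  where "mat_scale s z A = Mat (\<lambda>a b. s z (entry A a b))"

lemma complex_algebra_mat_scale:
  assumes "complex_algebra s"
  shows "complex_algebra (mat_scale s :: complex \<Rightarrow> ('b::finite, 'k::ring_1) sqmat \<Rightarrow> _)"
proof -
  interpret complex_algebra s by (fact assms)
  show ?thesis
    by standard (auto intro!: sqmat_eqI simp: mat_scale_def times_sqmat_def scale_right_distrib
        scale_left_distrib mult_scale_left mult_scale_right scale_sum_right)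
qed

text \<open>The operator on functions that sends phi to the function with value t(a) phi(g(a)) at a.
  Products therefore compose the maps \<open>g\<close> in reversed order.\<close>

definition monomial_mat :: "('b \<Rightarrow> 'b) \<Rightarrow> ('b \<Rightarrow> 'k) \<Rightarrow> ('b, 'k::zero) sqmat"
  where "monomial_mat g t = Mat (\<lambda>a b. if b = g a then t a else 0)"

lemma entry_monomial_mat: "entry (monomial_mat g t) a b = (if b = g a then t a else 0)"
  by (simp add: monomial_mat_def)

lemma monomial_mat_mult:
  fixes t t' :: "'b::finite \<Rightarrow> 'k::ring_1"
  shows "monomial_mat g t * monomial_mat g' t' = monomial_mat (\<lambda>a. g' (g a)) (\<lambda>a. t a * t' (g a))"
proof (rule sqmat_eqI)
  fix a b
  have "(\<Sum>d\<in>UNIV. (if d = g a then t a else 0) * (if b = g' d then t' d else 0))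
      = (\<Sum>d\<in>UNIV. if d = g a then t a * (if b = g' d then t' d else 0) else 0)"
    by (intro sum.cong) auto
  then show "entry (monomial_mat g t * monomial_mat g' t') a b
      = entry (monomial_mat (\<lambda>a. g' (g a)) (\<lambda>a. t a * t' (g a))) a b"
    by (simp add: times_sqmat_def monomial_mat_def)
qed

lemma one_eq_monomial_mat: "(1 :: ('b::finite, 'k::ring_1) sqmat) = monomial_mat (\<lambda>a. a) (\<lambda>a. 1)"
  by (simp add: one_sqmat_def monomial_mat_def)

lemma monomial_mat_add:
  "monomial_mat g t + monomial_mat g t' = monomial_mat g (\<lambda>a. t a + t' a)"
  for t t' :: "'b::finite \<Rightarrow> 'k::ring_1"
  by (auto intro!: sqmat_eqI simp: entry_monomial_mat)

lemma monomial_mat_uminus: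
  "- monomial_mat g t = monomial_mat g (\<lambda>a. - t a)"
  for t :: "'b::finite \<Rightarrow> 'k::ring_1"
  by (auto simp: monomial_mat_def uminus_sqmat_def fun_eq_iff)

lemma monomial_mat_diff:
  "monomial_mat g t - monomial_mat g t' = monomial_mat g (\<lambda>a. t a - t' a)"
  for t t' :: "'b::finite \<Rightarrow> 'k::ring_1"
  by (auto simp: monomial_mat_def minus_sqmat_def fun_eq_iff)

lemma mat_scale_monomial_mat:
  assumes "complex_algebra s"
  shows "mat_scale s z (monomial_mat g t) = monomial_mat g (\<lambda>a. s z (t a))"
proof -
  interpret complex_algebra s by (fact assms)
  show ?thesis by (auto simp: monomial_mat_def mat_scale_def fun_eq_iff)
qed

text \<open>Makes \<open>'n signed_perm\<close> a finite type, as the index type of the matrix ring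
  has to be.\<close>

instance perm :: (finite) finite
proof
  have "inj (apply :: 'a perm \<Rightarrow> 'a \<Rightarrow> 'a)" by (auto intro!: injI perm_eqI)
  then show "finite (UNIV :: 'a perm set)" by (rule inj_on_finite) auto
qed

section \<open>The orbit of a point under signed permutations\<close>

type_synonym 'n signed_perm = "'n set \<times> 'n perm"

definition flip :: "'n \<Rightarrow> 'n signed_perm \<Rightarrow> 'n signed_perm" where
  "flip i = (\<lambda>(S, \<tau>). (if i \<in> S then S - {i} else insert i S, \<tau>))"

text \<open>Preimage and inverse make this a right action. Since \<open>monomial_mat_mult\<close>
  reverses the order as well, the resulting matrices multiply in the order of the
  permutations.\<close>

definition translate :: "'n perm \<Rightarrow> 'n signed_perm \<Rightarrow> 'n signed_perm" where
  "translate \<sigma> = (\<lambda>(S, \<tau>). (apply \<sigma> -` S, inverse \<sigma> * \<tau>))"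

definition point :: "('n \<Rightarrow> complex) \<Rightarrow> 'n signed_perm \<Rightarrow> 'n \<Rightarrow> complex" where
  "point a = (\<lambda>(S, \<tau>) i. (if i \<in> S then -1 else 1) * a (inverse \<tau> \<langle>$\<rangle> i))"

lemma flip_flip: "flip i (flip i b) = b" "flip i (flip j b) = flip j (flip i b)"
  by (auto simp: flip_def split: prod.splits)

lemma translate_1: "translate 1 = (\<lambda>b. b)"
  by (auto simp: translate_def)

lemma translate_mult: "translate (\<sigma> * \<tau>) = (\<lambda>b. translate \<tau> (translate \<sigma> b))"
  by (auto simp: translate_def apply_times mult.assoc fun_eq_iff)

lemma flip_translate: "flip i (translate \<sigma> b) = translate \<sigma> (flip (\<sigma> \<langle>$\<rangle> i) b)"
  by (auto simp: flip_def translate_def apply_inj split: prod.splits)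

lemma point_flip: "point a (flip i b) j = (if j = i then - point a b j else point a b j)"
  by (cases b; cases "j = i"; cases "j \<in> fst b"; cases "i \<in> fst b") (simp_all add: point_def flip_def)

lemma point_translate: "point a (translate \<sigma> b) i = point a b (\<sigma> \<langle>$\<rangle> i)"
  by (auto simp: point_def translate_def apply_times split: prod.splits)

text \<open>Signed permutations only permute the squares of the coordinates, so distinct squares at
  \<open>a\<close> keep x_i - x_j and x_i + x_j nonzero on the whole orbit.\<close>

lemma point_regular:
  assumes "inj (\<lambda>i. (a i)\<^sup>2)" "i \<noteq> j"
  shows "point a b i \<noteq> point a b j" "point a b i + point a b j \<noteq> 0"
proof -
  obtain S \<tau> where b: "b = (S, \<tau>)" by force
  have "(point a b i)\<^sup>2 \<noteq> (point a b j)\<^sup>2"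
    using injD[OF assms(1), of "inverse \<tau> \<langle>$\<rangle> i" "inverse \<tau> \<langle>$\<rangle> j"] assms(2)
    by (auto simp: b point_def power_mult_distrib apply_inj)
  then show "point a b i \<noteq> point a b j" "point a b i + point a b j \<noteq> 0"
    by (auto simp: power2_eq_iff eq_neg_iff_add_eq_0)
qed

section \<open>The Dunkl representation on a regular orbit\<close>

locale point_representation = complex_algebra scale + e: clifford_perm_relations e v
  for scale :: "complex \<Rightarrow> 'k::ring_1 \<Rightarrow> 'k" and e :: "'n::finite \<Rightarrow> 'k" and v :: "'n perm \<Rightarrow> 'k" +
  fixes a :: "'n \<Rightarrow> complex"
  assumes regular: "inj (\<lambda>i. (a i)\<^sup>2)"
begin

definition diag :: "('n signed_perm \<Rightarrow> complex) \<Rightarrow> ('n signed_perm, 'k) sqmat" where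
  "diag h = monomial_mat (\<lambda>b. b) (\<lambda>b. scale (h b) 1)"

definition X :: "'n \<Rightarrow> ('n signed_perm, 'k) sqmat" where
  "X i = diag (\<lambda>b. point a b i)"

text \<open>The two factors divide the labour: the flips commute, so anticommutation of the
  \<open>C i\<close> comes from \<open>e i\<close>, while the anticommutation of \<open>C i\<close>
  with \<open>X i\<close> comes from the flip, which negates coordinate i.\<close>

definition C :: "'n \<Rightarrow> ('n signed_perm, 'k) sqmat" where
  "C i = monomial_mat (flip i) (\<lambda>_. e i)"

definition W :: "'n perm \<Rightarrow> ('n signed_perm, 'k) sqmat" where
  "W \<sigma> = monomial_mat (translate \<sigma>) (\<lambda>_. v \<sigma>)"

lemma diag_mult: "diag g * diag h = diag (\<lambda>b. g b * h b)"
  by (simp add: diag_def monomial_mat_mult mult_scale_left)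

lemma diag_add: "diag g + diag h = diag (\<lambda>b. g b + h b)"
  by (simp add: diag_def monomial_mat_add scale_left_distrib)

lemma diag_diff: "diag g - diag h = diag (\<lambda>b. g b - h b)"
  by (simp add: diag_def monomial_mat_diff scale_left_diff_distrib)

lemma diag_1: "diag (\<lambda>b. 1) = 1"
  by (simp add: diag_def one_eq_monomial_mat)

lemma diag_C: "diag h * C i = C i * diag (\<lambda>b. h (flip i b))"
  by (simp add: diag_def C_def monomial_mat_mult mult_scale_left mult_scale_right flip_flip)

lemma W_diag: "W \<sigma> * diag h = diag (\<lambda>b. h (translate \<sigma> b)) * W \<sigma>"
  by (simp add: diag_def W_def monomial_mat_mult mult_scale_left mult_scale_right)

sublocale L: complex_algebra "mat_scale scale :: complex \<Rightarrow> ('n signed_perm, 'k) sqmat \<Rightarrow> _"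
  by (rule complex_algebra_mat_scale) (rule complex_algebra_axioms)

lemma mat_scale_diag: "mat_scale scale z (diag h) = diag (\<lambda>b. z * h b)"
  by (simp add: diag_def mat_scale_monomial_mat[OF complex_algebra_axioms])

text \<open>The inverses are pointwise reciprocals, legitimate by regularity. This makes the
  commuting operators \<open>D i\<close> available as matrices.\<close>

sublocale clifford_poly_inverses C W X
  "\<lambda>i j. diag (\<lambda>b. inverse (point a b i - point a b j))"
  "\<lambda>i j. diag (\<lambda>b. inverse (point a b i + point a b j))"
proof
  show "C i * C i = 1" for i
    by (simp add: C_def monomial_mat_mult one_eq_monomial_mat flip_flip e.c_sq)
  show "C i * C j = - (C j * C i)" if "i \<noteq> j" for i j
    using e.c_anti[OF that]
    by (simp add: C_def monomial_mat_mult monomial_mat_uminus flip_flip(2)[of i j])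
  show "W 1 = 1" "W (\<sigma> * \<tau>) = W \<sigma> * W \<tau>" for \<sigma> \<tau>
    by (simp_all add: W_def monomial_mat_mult one_eq_monomial_mat translate_1 translate_mult e.w_one e.w_mult)
  show "W \<sigma> * C i = C (\<sigma> \<langle>$\<rangle> i) * W \<sigma>" for \<sigma> i
    by (simp add: W_def C_def monomial_mat_mult flip_translate e.w_c)
  show "X i * X j = X j * X i" for i j
    by (simp add: X_def diag_mult mult.commute)
  show "X i * C i = - (C i * X i)" for i
    by (simp add: X_def C_def diag_def monomial_mat_mult monomial_mat_uminus mult_scale_left
        mult_scale_right flip_flip point_flip)
  show "X i * C j = C j * X i" if "i \<noteq> j" for i j
    using that by (simp add: X_def diag_C point_flip)
  show "W \<sigma> * X i = X (\<sigma> \<langle>$\<rangle> i) * W \<sigma>" for \<sigma> i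
    by (simp add: X_def W_diag point_translate)
qed (simp_all add: X_def diag_mult diag_add diag_diff diag_1 point_regular[OF regular])

lemma ex_representation:
  assumes "rational_DAHCA u scaleH \<gamma>"
  obtains \<Phi> where "algebra_hom scaleH (mat_scale scale) \<Phi>"
    "\<And>i. \<Phi> (\<gamma> (HX i)) = X i" "\<And>i. \<Phi> (\<gamma> (HC i)) = C i"
proof -
  interpret H: rational_DAHCA u scaleH \<gamma> by (fact assms)
  let ?u = "mat_scale scale u 1 :: ('n signed_perm, 'k) sqmat"
  \<comment> \<open>The generators \<open>HY i\<close> go to \<open>D i\<close> times the scalar
    matrix of \<open>u\<close>.\<close>
  define \<Gamma> where "\<Gamma> = case_hgen X (\<lambda>i. ?u * D i) C W"
  interpret F: algebra_hom fscale "mat_scale scale" "free_eval (mat_scale scale) \<Gamma>"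
    by (rule L.algebra_hom_free_eval)
  have "\<forall>r\<in>DAHCA_relators ?u X (\<lambda>i. ?u * D i) C W. r = 0"
    by (rule DAHCA_relators_eq_0) (simp add: L.mult_scale_left L.mult_scale_right)
  then have "free_eval (mat_scale scale) \<Gamma> r = 0"
    if "r \<in> DAHCA_relators (Poly_Mapping.single 0 u)
       (\<lambda>i. fgen (HX i)) (\<lambda>i. fgen (HY i)) (\<lambda>i. fgen (HC i)) (\<lambda>\<sigma>. fgen (HW \<sigma>))" for r
    using that F.hom_DAHCA_relators_eq_0_iff[of "Poly_Mapping.single 0 u" "\<lambda>i. fgen (HX i)"
      "\<lambda>i. fgen (HY i)" "\<lambda>i. fgen (HC i)" "\<lambda>\<sigma>. fgen (HW \<sigma>)"]
    by (simp add: L.free_eval_fgen L.free_eval_single \<Gamma>_def)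
  then obtain \<Phi> where "algebra_hom scaleH (mat_scale scale) \<Phi>" "\<And>g. \<Phi> (\<gamma> g) = \<Gamma> g"
    using H.lift_hom[OF L.complex_algebra_axioms] by metis
  then show ?thesis by (intro that[of \<Phi>]) (auto simp: \<Gamma>_def)
qed

end

section \<open>Polynomials\<close>

text \<open>A monomial acts as a succession of variables. The factor \<open>f\<close> stays
  arbitrary because a sum of exponent vectors is applied in two stages.\<close>

lemma poly_mapping_single_induct:
  fixes \<beta> :: "'n \<Rightarrow>\<^sub>0 nat"
  assumes "P f" "\<And>i f. P f \<Longrightarrow> P (mvar i * f)"
  shows "P (Poly_Mapping.single \<beta> 1 * f :: 'n mpoly)"
  using assms(1)
proof (induction \<beta> arbitrary: f rule: poly_mapping_induct_single_add)
  case (single i d)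
  show ?case
  proof (induction d)
    case 0
    show ?case using single by simp
  next
    case (Suc d)
    have "Poly_Mapping.single (Poly_Mapping.single i (Suc d)) 1
        = mvar i * Poly_Mapping.single (Poly_Mapping.single i d) 1"
      by (simp add: mvar_def mult_single flip: single_add)
    then show ?case using Suc assms(2) by (simp add: mult.assoc)
  qed
next
  case (add \<beta> \<beta>')
  have "Poly_Mapping.single (\<beta> + \<beta>') 1 * f
      = Poly_Mapping.single \<beta> 1 * (Poly_Mapping.single \<beta>' 1 * f)"
    by (simp add: mult_single flip: mult.assoc)
  then show ?case using add by metis
qed

text \<open>Polynomials as an algebra generated by the variables. The \<open>mvar\<close> case adds
  one variable on the left, the form in which \<open>y i\<close> will be pushed through.\<close>

lemma mpoly_induct [case_names one add scale mvar]:
  fixes f :: "'n mpoly"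
  assumes "P 1" "\<And>f g. P f \<Longrightarrow> P g \<Longrightarrow> P (f + g)" "\<And>z f. P f \<Longrightarrow> P (fscale z f)"
    "\<And>i f. P f \<Longrightarrow> P (mvar i * f)"
  shows "P f"
proof (induction f rule: poly_mapping_induct_single_add)
  case (single \<beta> z)
  have "P (Poly_Mapping.single \<beta> 1 * 1)"
    using assms(1,4) by (rule poly_mapping_single_induct)
  from assms(3)[OF this, of z] show ?case by simp
qed (rule assms)

section \<open>Evaluation of polynomials\<close>

definition mpoly_eval :: "('n::finite \<Rightarrow> complex) \<Rightarrow> 'n mpoly \<Rightarrow> complex" where
  "mpoly_eval a = lin_ext (*) (\<lambda>\<beta>. \<Prod>i\<in>UNIV. a i ^ Poly_Mapping.lookup \<beta> i)"

lemma complex_algebra_complex: "complex_algebra (*)"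
  by standard (simp_all add: algebra_simps)

lemma mpoly_eval_add: "mpoly_eval a (f + g) = mpoly_eval a f + mpoly_eval a g"
  unfolding mpoly_eval_def
  by (rule lin_ext_add[OF complex_algebra.vs[OF complex_algebra_complex]])

lemma mpoly_eval_fscale: "mpoly_eval a (fscale z f) = z * mpoly_eval a f"
  unfolding mpoly_eval_def
  by (rule lin_ext_fscale[OF complex_algebra.vs[OF complex_algebra_complex]])

lemma mpoly_eval_single:
  "mpoly_eval a (Poly_Mapping.single \<beta> z) = z * (\<Prod>i\<in>UNIV. a i ^ Poly_Mapping.lookup \<beta> i)"
  unfolding mpoly_eval_def
  by (rule lin_ext_single[OF complex_algebra.vs[OF complex_algebra_complex]])

lemma mpoly_eval_one: "mpoly_eval a 1 = 1"
  by (simp add: mpoly_eval_single flip: single_one)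

lemma mpoly_eval_mvar_mult: "mpoly_eval a (mvar i * f) = a i * mpoly_eval a f"
proof -
  have "mpoly_eval a (mvar i * f) = mpoly_eval a (mvar i) * mpoly_eval a f"
    unfolding mpoly_eval_def
    by (rule complex_algebra.lin_ext_mult[OF complex_algebra_complex])
      (simp add: lookup_add power_add prod.distrib)
  also have "mpoly_eval a (mvar i) = (\<Prod>j\<in>UNIV. a j ^ Poly_Mapping.lookup (Poly_Mapping.single i 1) j)"
    by (simp add: mvar_def mpoly_eval_single)
  also have "\<dots> = (\<Prod>j\<in>UNIV. if j = i then a i else 1)"
    by (intro prod.cong) (auto simp: lookup_single when_def)
  finally show ?thesis by simp
qed

text \<open>The bound 2 makes exponents recoverable from powers; both bases chosen below rely on
  it.\<close>

lemma ex_nat_notin_finite: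
  fixes A :: "'a::semiring_char_0 set"
  assumes "finite A"
  shows "\<exists>n\<ge>2::nat. of_nat n \<notin> A"
proof (rule ccontr)
  assume "\<not> ?thesis"
  then have "of_nat ` {2::nat..} \<subseteq> A" by auto
  then have "finite (of_nat ` {2::nat..} :: 'a set)" using assms finite_subset by blast
  then have "finite {2::nat..}" by (rule finite_imageD) (auto simp: inj_on_def)
  then show False using infinite_Ici by blast
qed

text \<open>Substituting \<open>t ^ N ^ idx i\<close> for the variable number \<open>idx i\<close> turns a nonzero polynomial
  into a nonzero polynomial in \<open>t\<close>, provided \<open>N\<close> avoids finitely many values.\<close>

lemma ex_regular_eval_nonzero:
  fixes f :: "'n::finite mpoly"
  assumes "f \<noteq> 0"
  obtains a where "inj (\<lambda>i. (a i)\<^sup>2)" "mpoly_eval a f \<noteq> 0"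
proof -
  obtain idx :: "'n \<Rightarrow> nat" where idx: "inj idx"
    using finite_imp_inj_to_nat_seg[of "UNIV :: 'n set"] by auto
  \<comment> \<open>The difference of the weights of two exponent vectors, as a polynomial in the
    base N. Injectivity of \<open>idx\<close> keeps its coefficients separate.\<close>
  define d where "d = (\<lambda>(\<beta>, \<beta>'). \<Sum>i\<in>UNIV.
    monom (real (Poly_Mapping.lookup \<beta> i) - real (Poly_Mapping.lookup \<beta>' i)) (idx i))"
  have poly_d: "poly (d (\<beta>, \<beta>')) x = (\<Sum>i\<in>UNIV. real (Poly_Mapping.lookup \<beta> i) * x ^ idx i)
      - (\<Sum>i\<in>UNIV. real (Poly_Mapping.lookup \<beta>' i) * x ^ idx i)" for \<beta> \<beta>' x
    by (simp add: d_def poly_sum poly_monom sum_subtractf left_diff_distrib)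
  have d_nz: "d (\<beta>, \<beta>') \<noteq> 0" if neq: "\<beta> \<noteq> \<beta>'" for \<beta> \<beta>'
  proof -
    obtain i where "Poly_Mapping.lookup \<beta> i \<noteq> Poly_Mapping.lookup \<beta>' i"
      using neq by (metis poly_mapping_eqI)
    moreover have "coeff (d (\<beta>, \<beta>')) (idx i)
        = real (Poly_Mapping.lookup \<beta> i) - real (Poly_Mapping.lookup \<beta>' i)"
      using idx by (simp add: d_def coeff_sum inj_eq)
    ultimately show ?thesis by auto
  qed
  define pairs where "pairs = {(\<beta>, \<beta>') \<in> Poly_Mapping.keys f \<times> Poly_Mapping.keys f. \<beta> \<noteq> \<beta>'}"
  have "finite pairs" unfolding pairs_def
    by (rule finite_subset[of _ "Poly_Mapping.keys f \<times> Poly_Mapping.keys f"]) auto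
  then have "finite (\<Union>b\<in>pairs. {x. poly (d b) x = 0})"
    using d_nz by (auto simp: pairs_def intro!: poly_roots_finite)
  \<comment> \<open>Avoiding the roots of all these differences gives the exponent vectors of
    \<open>f\<close> pairwise distinct weights.\<close>
  then obtain N :: nat where N: "N \<ge> 2" "\<And>b. b \<in> pairs \<Longrightarrow> poly (d b) (real N) \<noteq> 0"
    using ex_nat_notin_finite by force
  define wt where "wt \<beta> = (\<Sum>i\<in>UNIV. Poly_Mapping.lookup \<beta> i * N ^ idx i)" for \<beta>
  have wt: "wt \<beta> \<noteq> wt \<beta>'" if "\<beta> \<in> Poly_Mapping.keys f" "\<beta>' \<in> Poly_Mapping.keys f" "\<beta> \<noteq> \<beta>'" for \<beta> \<beta>'
  proof
    assume "wt \<beta> = wt \<beta>'"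
    then have "real (wt \<beta>) = real (wt \<beta>')" by simp
    then have "poly (d (\<beta>, \<beta>')) (real N) = 0" by (simp add: poly_d wt_def)
    then show False using N(2)[of "(\<beta>, \<beta>')"] that by (simp add: pairs_def)
  qed
  \<comment> \<open>The univariate polynomial after the substitution. Distinct weights prevent
    coefficients of \<open>f\<close> from merging, so \<open>F\<close> is nonzero.\<close>
  define F where "F = (\<Sum>\<beta>\<in>Poly_Mapping.keys f. monom (Poly_Mapping.lookup f \<beta>) (wt \<beta>))"
  obtain \<beta> where \<beta>: "\<beta> \<in> Poly_Mapping.keys f" using assms by (metis keys_eq_empty all_not_in_conv)
  have "coeff F (wt \<beta>) = (\<Sum>\<beta>'\<in>Poly_Mapping.keys f. if \<beta>' = \<beta> then Poly_Mapping.lookup f \<beta>' else 0)"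
    unfolding F_def coeff_sum using wt \<beta> by (intro sum.cong) auto
  then have "F \<noteq> 0" using \<beta> by (auto simp: in_keys_iff)
  then obtain t :: nat where t: "t \<ge> 2" "poly F (of_nat t) \<noteq> 0"
    using ex_nat_notin_finite[OF poly_roots_finite] by blast
  \<comment> \<open>The squares of these values are powers of t with exponents 2 N^(idx i), hence
    distinct because t and N are at least 2.\<close>
  define a where "a i = (of_nat t :: complex) ^ N ^ idx i" for i
  have "mpoly_eval a f = poly F (of_nat t)"
    by (simp add: mpoly_eval_def lin_ext_def F_def poly_sum poly_monom a_def wt_def power_sum
        mult.commute flip: power_mult)
  moreover have "inj (\<lambda>i. (a i)\<^sup>2)"
  proof (rule injI)
    fix i j assume "(a i)\<^sup>2 = (a j)\<^sup>2"
    then have "of_nat (t ^ (N ^ idx i * 2)) = (of_nat (t ^ (N ^ idx j * 2)) :: complex)"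
      by (simp add: a_def power_mult)
    then have "t ^ (N ^ idx i * 2) = t ^ (N ^ idx j * 2)" by (simp only: of_nat_eq_iff)
    then have "idx i = idx j" using t(1) N(1) by simp
    then show "i = j" using idx by (simp add: inj_eq)
  qed
  ultimately show ?thesis using that t(2) by metis
qed

section \<open>Permutations of the variables\<close>

lemma inj_map_key_apply: "inj (Poly_Mapping.map_key (apply \<sigma>) :: ('n \<Rightarrow>\<^sub>0 nat) \<Rightarrow> _)"
proof (rule injI)
  fix \<beta> \<beta>' :: "'n \<Rightarrow>\<^sub>0 nat"
  assume eq: "Poly_Mapping.map_key (apply \<sigma>) \<beta> = Poly_Mapping.map_key (apply \<sigma>) \<beta>'"
  have inj: "inj (apply \<sigma>)" by (simp add: bij_is_inj)
  have "Poly_Mapping.lookup \<beta> i = Poly_Mapping.lookup \<beta>' i" for i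
    using arg_cong[OF eq, of "\<lambda>\<beta>. Poly_Mapping.lookup \<beta> (inverse \<sigma> \<langle>$\<rangle> i)"]
    by (simp add: map_key.rep_eq[OF inj] apply_sequence)
  then show "\<beta> = \<beta>'" by (rule poly_mapping_eqI)
qed

lemma perm_mpoly_add: "perm_mpoly \<sigma> (f + g) = perm_mpoly \<sigma> f + perm_mpoly \<sigma> g"
  unfolding perm_mpoly_def by (rule map_key_plus[OF inj_map_key_apply])

text \<open>Coefficients are pulled back along composition with \<open>\<sigma>\<close>, so the
  exponent vector itself moves by the inverse.\<close>

lemma perm_mpoly_single:
  "perm_mpoly \<sigma> (Poly_Mapping.single \<beta> z)
    = Poly_Mapping.single (Poly_Mapping.map_key (apply (inverse \<sigma>)) \<beta>) z"
proof -
  have inj: "inj (apply \<tau>)" for \<tau> :: "'a perm" by (simp add: bij_is_inj)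
  have "Poly_Mapping.map_key (apply \<sigma>) (Poly_Mapping.map_key (apply (inverse \<sigma>)) \<beta>) = \<beta>"
    by (simp add: map_key_compose[OF inj inj] map_key_id flip: apply_times id_def[symmetric])
  then show ?thesis
    unfolding perm_mpoly_def
    using map_key_single[OF inj_map_key_apply, of \<sigma> "Poly_Mapping.map_key (apply (inverse \<sigma>)) \<beta>" z]
    by simp
qed

lemma perm_mpoly_mult: "perm_mpoly \<sigma> (f * g) = perm_mpoly \<sigma> f * perm_mpoly \<sigma> g"
proof (induction f rule: poly_mapping_induct_single_add)
  case (single \<beta> z)
  show ?case
  proof (induction g rule: poly_mapping_induct_single_add)
    case (single \<beta>' z')
    have "inj (apply (inverse \<sigma>))" by (simp add: bij_is_inj)
    then show ?case by (simp add: mult_single perm_mpoly_single map_key_plus)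
  qed (simp add: perm_mpoly_add distrib_left)
qed (simp add: perm_mpoly_add distrib_right)

lemma perm_mpoly_mvar: "perm_mpoly \<sigma> (mvar i) = mvar (\<sigma> \<langle>$\<rangle> i)"
proof -
  have "inj (apply (inverse \<sigma>))" by (simp add: bij_is_inj)
  from map_key_single[OF this, of "\<sigma> \<langle>$\<rangle> i" "1::nat"]
  show ?thesis by (simp add: mvar_def perm_mpoly_single apply_sequence)
qed

lemma perm_mpoly_one: "perm_mpoly \<sigma> 1 = 1"
proof -
  have "inj (apply (inverse \<sigma>))" by (simp add: bij_is_inj)
  then have "perm_mpoly \<sigma> (Poly_Mapping.single 0 1) = Poly_Mapping.single 0 1"
    by (simp only: perm_mpoly_single map_key_zero)
  then show ?thesis by simp
qed

lemma perm_mpoly_fscale: "perm_mpoly \<sigma> (fscale z f) = fscale z (perm_mpoly \<sigma> f)"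
  by (rule poly_mapping_eqI) (simp add: perm_mpoly_def map_key.rep_eq[OF inj_map_key_apply])

section \<open>Normal forms and cancellation\<close>

definition toggle :: "'n \<Rightarrow> 'n set \<Rightarrow> 'n set" where
  "toggle i S = (if i \<in> S then S - {i} else insert i S)"

text \<open>Move \<open>c i\<close> to the right, collecting a sign at each factor, up to the place
  of i in the list. There it is inserted, or it cancels against an existing
  \<open>c i\<close>.\<close>

lemma (in clifford_perm_relations) c_mult_prod_list:
  assumes "distinct es" "i \<in> set es"
  shows "\<exists>s\<in>{1, -1}. c i * prod_list (map c (filter (\<lambda>l. l \<in> S) es))
    = s * prod_list (map c (filter (\<lambda>l. l \<in> toggle i S) es))"
  using assms
proof (induction es)
  case (Cons l es)
  show ?case
  proof (cases "l = i")
    case True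
    have "filter (\<lambda>l. l \<in> toggle i S) es = filter (\<lambda>l. l \<in> S) es"
      using Cons(2) True by (intro filter_cong) (auto simp: toggle_def)
    then show ?thesis using True by (auto simp: toggle_def c_sq simp flip: mult.assoc)
  next
    case False
    then have "l \<in> toggle i S \<longleftrightarrow> l \<in> S" by (auto simp: toggle_def)
    have "\<exists>s\<in>{1, -1}. c i * prod_list (map c (filter (\<lambda>l. l \<in> S) es))
        = s * prod_list (map c (filter (\<lambda>l. l \<in> toggle i S) es))"
      by (rule Cons.IH) (use Cons.prems False in auto)
    then obtain s where s: "s \<in> {1, -1}" "c i * prod_list (map c (filter (\<lambda>l. l \<in> S) es))
        = s * prod_list (map c (filter (\<lambda>l. l \<in> toggle i S) es))"
      by (rule bexE)
    have "c i * (c l * t) = - (c l * (c i * t))" for t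
      using c_anti[of i l] False by (simp flip: mult.assoc)
    then show ?thesis
      using s \<open>l \<in> toggle i S \<longleftrightarrow> l \<in> S\<close> by auto
  qed
qed simp

lemma (in clifford_perm_relations) prod_list_invertible:
  "prod_list (map c es) * prod_list (map c (rev es)) = 1"
proof (induction es)
  case (Cons l es)
  have "prod_list (map c (l # es)) * prod_list (map c (rev (l # es)))
      = c l * (prod_list (map c es) * prod_list (map c (rev es))) * c l"
    by (simp add: mult.assoc)
  then show ?case using Cons c_sq by simp
qed simp

definition enumeration :: "'n::finite list" where
  "enumeration = (SOME es. set es = UNIV \<and> distinct es)"

lemma enumeration: "set (enumeration :: 'n::finite list) = UNIV" "distinct (enumeration :: 'n list)"
  using someI_ex[OF finite_distinct_list[OF finite, of "UNIV :: 'n set"]]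
  unfolding enumeration_def by auto

definition clifford_monomial :: "('n::finite \<Rightarrow> 'a::monoid_mult) \<Rightarrow> 'n set \<Rightarrow> 'a" where
  "clifford_monomial c S = prod_list (map c (filter (\<lambda>l. l \<in> S) enumeration))"

lemma (in clifford_perm_relations) c_mult_clifford_monomial:
  "\<exists>s\<in>{1, -1}. c i * clifford_monomial c S = s * clifford_monomial c (toggle i S)"
  unfolding clifford_monomial_def by (rule c_mult_prod_list) (simp_all add: enumeration)

lemma (in complex_algebra) generated_subalgebra_diff:
  assumes "a \<in> generated_subalgebra scale S" "b \<in> generated_subalgebra scale S"
  shows "a - b \<in> generated_subalgebra scale S"
  using generated_subalgebra.add[OF assms(1) generated_subalgebra.scale[OF assms(2), of "-1"]] by simp

lemma (in complex_algebra) generated_subalgebra_zero: "0 \<in> generated_subalgebra scale S"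
  using generated_subalgebra.scale[OF generated_subalgebra.one, of scale 0 S] by simp

text \<open>Cancellation inside the subalgebra is the uniqueness demanded by the definite
  description, so any solution \<open>q\<close> in it is the fraction.\<close>

lemma (in complex_algebra) left_fraction_eq:
  fixes S
  defines "A \<equiv> generated_subalgebra scale S"
  assumes "q \<in> A" "g * q = h" and cancel: "\<And>r. r \<in> A \<Longrightarrow> g * r = 0 \<Longrightarrow> r = 0"
  shows "left_fraction A h g = q"
  unfolding left_fraction_def
proof (rule the_equality)
  fix r assume "r \<in> A \<and> g * r = h"
  then have "r - q \<in> A" "g * (r - q) = 0"
    using assms generated_subalgebra_diff by (auto simp: right_diff_distrib)
  then show "r = q" using cancel[of "r - q"] by simp
qed (use assms in simp)

section \<open>Reading off coefficients in the representation\<close>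

context point_representation
begin

lemma hom_polynomial:
  assumes "algebra_hom fscale (mat_scale scale) \<psi>" "\<And>i. \<psi> (mvar i) = X i"
  shows "\<psi> f = diag (\<lambda>b. mpoly_eval (point a b) f)"
proof -
  interpret \<psi>: algebra_hom fscale "mat_scale scale" \<psi> by (fact assms(1))
  show ?thesis
    by (induction f rule: mpoly_induct)
      (simp_all add: \<psi>.hom_one \<psi>.hom_mult \<psi>.add \<psi>.scale mpoly_eval_one mpoly_eval_add
        mpoly_eval_fscale mpoly_eval_mvar_mult diag_1 diag_add diag_mult mat_scale_diag assms(2) X_def)
qed

lemma C_prod_list:
  "prod_list (map C es) = monomial_mat (fold flip es) (\<lambda>_. prod_list (map e es))"
  by (induction es) (simp_all add: one_eq_monomial_mat C_def monomial_mat_mult id_def)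

lemma fold_flip:
  "distinct es \<Longrightarrow> set es \<inter> S = {} \<Longrightarrow> fold flip es (S, \<tau>) = (S \<union> set es, \<tau>)"
  by (induction es arbitrary: S) (auto simp: flip_def)

text \<open>The monomial of \<open>S'\<close> flips exactly the coordinates in \<open>S'\<close> and
  so leads from \<open>({}, \<tau>)\<close> to \<open>(S', \<tau>)\<close>. Different monomials
  occupy different columns of this row, and each coefficient can be isolated.\<close>

lemma entry_normal_form:
  "entry (\<Sum>S'\<in>UNIV. diag (h S') * clifford_monomial C S') ({}, \<tau>) (S, \<tau>)
    = scale (h S ({}, \<tau>)) (clifford_monomial e S)"
proof -
  have "entry (diag g * clifford_monomial C S') ({}, \<tau>) (S, \<tau>)
      = (if S' = S then scale (g ({}, \<tau>)) (clifford_monomial e S) else 0)" for g S'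
  proof -
    have "fold flip (filter (\<lambda>l. l \<in> S') enumeration) ({}, \<tau>) = (S', \<tau>)"
      by (subst fold_flip) (auto simp: enumeration)
    then show ?thesis
      by (auto simp: clifford_monomial_def C_prod_list diag_def monomial_mat_mult entry_monomial_mat
          mult_scale_left)
  qed
  then show ?thesis by (simp add: entry_sum)
qed

text \<open>The reversed product is a right inverse of the monomial, which leaves
  \<open>scale z 1 = 0\<close> with 1 nonzero.\<close>

lemma scale_clifford_monomial_eq_0:
  assumes "scale z (clifford_monomial e S) = 0"
  shows "z = 0"
proof -
  define es where "es = filter (\<lambda>l. l \<in> S) enumeration"
  have "scale z (clifford_monomial e S * prod_list (map e (rev es))) = 0"
    unfolding mult_scale_left[symmetric] assms by simp
  moreover have "clifford_monomial e S * prod_list (map e (rev es)) = 1"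
    unfolding clifford_monomial_def es_def by (rule e.prod_list_invertible)
  ultimately show ?thesis by (simp add: scale_eq_0_iff)
qed

end

section \<open>Normal forms in the algebra\<close>

locale DAHCA_with_polynomials = rational_DAHCA u scale \<gamma> + I: algebra_hom fscale scale \<iota>
  for u :: complex and scale :: "complex \<Rightarrow> 'h::ring_1 \<Rightarrow> 'h"
    and \<gamma> :: "'n::finite hgen \<Rightarrow> 'h" and \<iota> :: "'n mpoly \<Rightarrow> 'h" +
  assumes \<iota>_mvar: "\<iota> (mvar i) = \<gamma> (HX i)"
begin

abbreviation "x \<equiv> \<lambda>i. \<gamma> (HX i)"
abbreviation "y \<equiv> \<lambda>i. \<gamma> (HY i)"
abbreviation "c \<equiv> \<lambda>i. \<gamma> (HC i)"
abbreviation "w \<equiv> \<lambda>\<sigma>. \<gamma> (HW \<sigma>)"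
abbreviation "XC \<equiv> generated_subalgebra scale (range x \<union> range c)"

lemma relators_eq_0: "\<forall>r\<in>DAHCA_relators (scale u 1) x y c w. r = 0"
proof -
  interpret E: algebra_hom fscale scale "free_eval scale \<gamma>" by (rule algebra_hom_free_eval)
  show ?thesis
    using relator_eq_0 E.hom_DAHCA_relators_eq_0_iff[of "Poly_Mapping.single 0 u" "\<lambda>i. fgen (HX i)"
      "\<lambda>i. fgen (HY i)" "\<lambda>i. fgen (HC i)" "\<lambda>\<sigma>. fgen (HW \<sigma>)"]
    by (simp add: free_eval_fgen free_eval_single)
qed

sublocale clifford_poly_relations c w x
  by (rule DAHCA_relations(1)[OF relators_eq_0])

lemma y_x: "i \<noteq> j \<Longrightarrow> y j * x i = x i * y j + scale u ((1 + c j * c i) * w \<langle>j \<leftrightarrow> i\<rangle>)"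
  using DAHCA_relations(2)[OF relators_eq_0] by (simp add: mult_scale_left)

lemma y_x_same: "y i * x i = x i * y i - scale u (\<Sum>k\<in>-{i}. (1 + c k * c i) * w \<langle>k \<leftrightarrow> i\<rangle>)"
  using DAHCA_relations(3)[OF relators_eq_0] by (simp add: mult_scale_left)

lemma w_\<iota>: "w \<sigma> * \<iota> f = \<iota> (perm_mpoly \<sigma> f) * w \<sigma>"
proof (induction f rule: mpoly_induct)
  case (mvar i f)
  have "w \<sigma> * \<iota> (mvar i * f) = x (\<sigma> \<langle>$\<rangle> i) * (w \<sigma> * \<iota> f)"
    by (simp add: I.hom_mult \<iota>_mvar w_x flip: mult.assoc)
  then show ?case
    by (simp add: mvar I.hom_mult \<iota>_mvar perm_mpoly_mult perm_mpoly_mvar mult.assoc)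
qed (simp_all add: I.hom_one I.add I.scale perm_mpoly_one perm_mpoly_add perm_mpoly_fscale
    distrib_left distrib_right mult_scale_left mult_scale_right)

text \<open>One may take for \<open>f'\<close> the polynomial \<open>f\<close> with the sign of the
  variable i changed; for closing up the normal forms its existence suffices.\<close>

lemma c_\<iota>: "\<exists>f'. c i * \<iota> f = \<iota> f' * c i"
proof (induction f rule: mpoly_induct)
  case one
  show ?case by (rule exI[of _ 1]) (simp add: I.hom_one)
next
  case (add f g)
  then obtain f' g' where "c i * \<iota> f = \<iota> f' * c i" "c i * \<iota> g = \<iota> g' * c i" by blast
  then show ?case by (intro exI[of _ "f' + g'"]) (simp add: I.add distrib_left distrib_right)
next
  case (scale z f)
  then obtain f' where "c i * \<iota> f = \<iota> f' * c i" by blast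
  then show ?case
    by (intro exI[of _ "fscale z f'"]) (simp add: I.scale mult_scale_left mult_scale_right)
next
  case (mvar l f)
  then obtain f' where f': "c i * \<iota> f = \<iota> f' * c i" by blast
  have "c i * x l = x l * c i \<or> c i * x l = - (x l * c i)"
    using x_c[of l i] x_c_same[of i] by (cases "l = i") auto
  then have "c i * \<iota> (mvar l * f) = x l * (c i * \<iota> f) \<or> c i * \<iota> (mvar l * f) = - (x l * (c i * \<iota> f))"
    by (auto simp: I.hom_mult \<iota>_mvar simp flip: mult.assoc)
  then have "c i * \<iota> (mvar l * f) = \<iota> (mvar l * f') * c i \<or>
      c i * \<iota> (mvar l * f) = \<iota> (- (mvar l * f')) * c i"
    by (simp add: I.hom_mult \<iota>_mvar I.neg f' mult.assoc)
  then show ?case by blast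
qed

definition normal_forms :: "'h set" where
  "normal_forms = range (\<lambda>p. \<Sum>S\<in>UNIV. \<iota> (p S) * clifford_monomial c S)"

lemma normal_formI:
  "a = (\<Sum>S\<in>UNIV. \<iota> (p S) * clifford_monomial c S) \<Longrightarrow> a \<in> normal_forms"
  unfolding normal_forms_def by blast

lemma normal_form_single: "\<iota> f * clifford_monomial c S \<in> normal_forms"
proof -
  have "(\<Sum>S'\<in>UNIV. \<iota> (if S' = S then f else 0) * clifford_monomial c S')
      = (\<Sum>S'\<in>UNIV. if S' = S then \<iota> f * clifford_monomial c S' else 0)"
    by (intro sum.cong) (auto simp: I.zero)
  then have "\<iota> f * clifford_monomial c S
      = (\<Sum>S'\<in>UNIV. \<iota> (if S' = S then f else 0) * clifford_monomial c S')" by simp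
  then show ?thesis by (rule normal_formI)
qed

lemma normal_form_add:
  assumes "a \<in> normal_forms" "b \<in> normal_forms"
  shows "a + b \<in> normal_forms"
proof -
  obtain p q where "a = (\<Sum>S\<in>UNIV. \<iota> (p S) * clifford_monomial c S)"
    "b = (\<Sum>S\<in>UNIV. \<iota> (q S) * clifford_monomial c S)"
    using assms by (auto simp: normal_forms_def)
  then have "a + b = (\<Sum>S\<in>UNIV. \<iota> (p S + q S) * clifford_monomial c S)"
    by (simp add: I.add distrib_right sum.distrib)
  then show ?thesis by (rule normal_formI)
qed

lemma normal_form_sum: "(\<And>k. k \<in> A \<Longrightarrow> F k \<in> normal_forms) \<Longrightarrow> sum F A \<in> normal_forms"
proof (induction A rule: infinite_finite_induct)
  case empty
  show ?case using normal_form_single[of 0] by (simp add: I.zero)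
next
  case infinite
  then show ?case using normal_form_single[of 0] by (simp add: I.zero)
qed (simp add: normal_form_add)

lemma normal_form_mult:
  assumes gen: "\<And>f S. g * (\<iota> f * clifford_monomial c S) \<in> normal_forms"
    and "a \<in> normal_forms"
  shows "g * a \<in> normal_forms"
proof -
  obtain p where "a = (\<Sum>S\<in>UNIV. \<iota> (p S) * clifford_monomial c S)"
    using assms(2) by (auto simp: normal_forms_def)
  then show ?thesis using gen by (auto simp: sum_distrib_left intro!: normal_form_sum)
qed

text \<open>Left multiplication by a generator sends a term to a term: a variable joins the
  polynomial, and a Clifford generator passes the polynomial and toggles the monomial up to sign.
  Stability under all of \<open>XC\<close> follows, and applying it to 1 gives the spanning half of
  PBW.\<close>

lemma XC_mult_normal_form: "q \<in> XC \<Longrightarrow> a \<in> normal_forms \<Longrightarrow> q * a \<in> normal_forms"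
proof (induction q arbitrary: a rule: generated_subalgebra.induct)
  case (gen q)
  show ?case
  proof (rule normal_form_mult[OF _ gen(2)])
    fix f S
    from gen(1) consider l where "q = x l" | l where "q = c l" by auto
    then show "q * (\<iota> f * clifford_monomial c S) \<in> normal_forms"
    proof cases
      case 1
      then show ?thesis
        using normal_form_single[of "mvar l * f" S] by (simp add: I.hom_mult \<iota>_mvar mult.assoc)
    next
      case 2
      obtain f' where f': "c l * \<iota> f = \<iota> f' * c l" using c_\<iota> by blast
      obtain s where s: "s \<in> {1, -1}" "c l * clifford_monomial c S = s * clifford_monomial c (toggle l S)"
        using c_mult_clifford_monomial by blast
      have "q * (\<iota> f * clifford_monomial c S) = \<iota> f' * (s * clifford_monomial c (toggle l S))"
        using f' by (simp add: 2 flip: s(2) mult.assoc)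
      also have "\<dots> = \<iota> f' * clifford_monomial c (toggle l S) \<or>
          \<dots> = \<iota> (- f') * clifford_monomial c (toggle l S)"
        using s(1) by (auto simp: I.neg)
      finally show ?thesis using normal_form_single by auto
    qed
  qed
next
  case (scale q z)
  \<comment> \<open>A scalar is multiplication by a constant polynomial, which preserves normal
    forms.\<close>
  have "scale z q * a = \<iota> (fscale z 1) * (q * a)"
    by (simp add: I.scale I.hom_one mult_scale_left)
  moreover have "\<iota> (fscale z 1) * b \<in> normal_forms" if "b \<in> normal_forms" for b
    using that
    by (rule normal_form_mult[rotated]) (metis normal_form_single I.hom_mult mult.assoc)
  ultimately show ?case using scale by simp
qed (simp_all add: distrib_right normal_form_add mult.assoc)

lemma XC_normal_form:
  assumes "q \<in> XC"
  obtains p where "q = (\<Sum>S\<in>UNIV. \<iota> (p S) * clifford_monomial c S)"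
proof -
  have "1 \<in> normal_forms"
    using normal_form_single[of 1 "{}"] by (simp add: I.hom_one clifford_monomial_def)
  then have "q \<in> normal_forms" using XC_mult_normal_form[OF assms, of 1] by simp
  then show ?thesis using that by (auto simp: normal_forms_def)
qed

text \<open>Since \<open>g\<close> acts invertibly on every regular orbit, \<open>q\<close> acts by
  zero there. If some coefficient \<open>p S\<close> were nonzero, an orbit through a regular point
  where it does not vanish would show a nonzero matrix entry.\<close>

lemma XC_eq_0:
  assumes K: "clifford_semidirect_algebra (scaleK :: complex \<Rightarrow> 'k::ring_1 \<Rightarrow> 'k) (\<kappa> :: 'n kgen \<Rightarrow> 'k)"
    and q: "q \<in> XC" and g: "g = x i - x k \<or> g = x i + x k" "i \<noteq> k" "g * q = 0"
  shows "q = 0"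
proof -
  interpret K: clifford_semidirect_algebra scaleK \<kappa> by (fact K)
  define e v where "e i = \<kappa> (KC i)" and "v \<sigma> = \<kappa> (KW \<sigma>)" for i \<sigma>
  interpret E: algebra_hom fscale scaleK "free_eval scaleK \<kappa>" by (rule K.algebra_hom_free_eval)
  have "\<forall>r\<in>K_relators e v. r = 0"
    using K.relator_eq_0 E.hom_K_relators_eq_0_iff[of "\<lambda>i. fgen (KC i)" "\<lambda>\<sigma>. fgen (KW \<sigma>)"]
    by (simp add: K.free_eval_fgen e_def[abs_def] v_def[abs_def])
  then interpret ev: clifford_perm_relations e v by (rule clifford_perm_relationsI)
  obtain p where p: "q = (\<Sum>S\<in>UNIV. \<iota> (p S) * clifford_monomial c S)"
    using XC_normal_form[OF q] .
  have "p S = 0" for S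
  proof (rule ccontr)
    assume "p S \<noteq> 0"
    then obtain a where a: "inj (\<lambda>i. (a i)\<^sup>2)" "mpoly_eval a (p S) \<noteq> 0"
      by (rule ex_regular_eval_nonzero)
    interpret R: point_representation scaleK e v a
      by unfold_locales (fact a(1))
    obtain \<Phi> where \<Phi>: "algebra_hom scale (mat_scale scaleK) \<Phi>"
      "\<And>i. \<Phi> (x i) = R.X i" "\<And>i. \<Phi> (c i) = R.C i"
      using R.ex_representation[OF rational_DAHCA_axioms] by blast
    interpret \<Phi>: algebra_hom scale "mat_scale scaleK" \<Phi> by (fact \<Phi>(1))
    have \<Phi>\<iota>: "\<Phi> (\<iota> f) = R.diag (\<lambda>b. mpoly_eval (point a b) f)" for f
      by (rule R.hom_polynomial[of "\<lambda>f. \<Phi> (\<iota> f)"])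
        (auto intro!: algebra_homI simp: complex_algebra_fscale complex_algebra_mat_scale K.complex_algebra_axioms
          I.add I.scale I.hom_mult I.hom_one \<Phi>.add \<Phi>.scale \<Phi>.hom_mult \<Phi>.hom_one \<iota>_mvar \<Phi>(2))
    have \<Phi>_list: "\<Phi> (prod_list (map c es)) = prod_list (map R.C es)" for es
      by (induction es) (simp_all add: \<Phi>.hom_one \<Phi>.hom_mult \<Phi>(3))
    have "\<Phi> g * \<Phi> q = 0" using g(3) \<Phi>.hom_mult[of g q] by (simp add: \<Phi>.zero)
    moreover have "\<exists>g'. g' * \<Phi> g = 1"
      using g(1,2) R.p_left[of i k] R.q_left[of i k] by (auto simp: \<Phi>.add \<Phi>.diff \<Phi>(2))
    then obtain g' where "g' * \<Phi> g = 1" by blast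
    ultimately have "\<Phi> q = 0"
      using mult.assoc[of g' "\<Phi> g" "\<Phi> q"] by simp
    then have "(\<Sum>S\<in>UNIV. R.diag (\<lambda>b. mpoly_eval (point a b) (p S)) * clifford_monomial R.C S) = 0"
      by (simp add: p \<Phi>.sum \<Phi>.hom_mult \<Phi>\<iota> \<Phi>_list clifford_monomial_def)
    \<comment> \<open>The base point \<open>({}, 1)\<close> represents \<open>a\<close> itself, so
      column S of its row contains the value of \<open>p S\<close> at \<open>a\<close>.\<close>
    then have "scaleK (mpoly_eval (point a ({}, 1)) (p S)) (clifford_monomial e S) = 0"
      using R.entry_normal_form[of "\<lambda>S b. mpoly_eval (point a b) (p S)" 1 S] by simp
    then have "mpoly_eval (point a ({}, 1)) (p S) = 0"
      by (rule R.scale_clifford_monomial_eq_0)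
    moreover have "inverse 1 = (1 :: 'n perm)" by (rule perm.inverse_neutral)
    ultimately show False using a(2) by (simp add: point_def)
  qed
  then show ?thesis by (simp add: p I.zero)
qed

text \<open>The fractions enter only through the equations they solve, so the induction on
  \<open>f\<close> can proceed by construction; that the solutions are the fractions is settled
  separately by cancellation.\<close>

definition Dunkl_parts :: "'n \<Rightarrow> 'n mpoly \<Rightarrow> ('n \<Rightarrow> 'h) \<Rightarrow> ('n \<Rightarrow> 'h) \<Rightarrow> bool" where
  "Dunkl_parts i f Q1 Q2 \<longleftrightarrow>
    (\<forall>k. k \<noteq> i \<longrightarrow> Q1 k \<in> XC \<and> Q2 k \<in> XC \<and>
      (x i - x k) * Q1 k = \<iota> f - \<iota> (perm_mpoly \<langle>k \<leftrightarrow> i\<rangle> f) \<and>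
      (x i + x k) * Q2 k = \<iota> f * c k * c i - c k * c i * \<iota> (perm_mpoly \<langle>k \<leftrightarrow> i\<rangle> f)) \<and>
    y i * \<iota> f = \<iota> f * y i - scale u (\<Sum>k\<in>-{i}. (Q1 k + Q2 k) * w \<langle>k \<leftrightarrow> i\<rangle>)"

lemma Dunkl_parts_one: "Dunkl_parts i 1 (\<lambda>_. 0) (\<lambda>_. 0)"
  by (simp add: Dunkl_parts_def generated_subalgebra_zero perm_mpoly_one I.hom_one)

lemma Dunkl_parts_add:
  assumes "Dunkl_parts i f P1 P2" "Dunkl_parts i g Q1 Q2"
  shows "Dunkl_parts i (f + g) (\<lambda>k. P1 k + Q1 k) (\<lambda>k. P2 k + Q2 k)"
proof -
  note P = assms(1)[unfolded Dunkl_parts_def] and Q = assms(2)[unfolded Dunkl_parts_def]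
  have "y i * \<iota> (f + g) = \<iota> (f + g) * y i
      - scale u (\<Sum>k\<in>-{i}. ((P1 k + Q1 k) + (P2 k + Q2 k)) * w \<langle>k \<leftrightarrow> i\<rangle>)"
    by (simp add: I.add distrib_left distrib_right P Q sum.distrib scale_right_distrib)
  then show ?thesis
    using P Q by (simp add: Dunkl_parts_def generated_subalgebra.add I.add perm_mpoly_add
        distrib_left[of "x i - _"] distrib_left[of "x i + _"] distrib_left[of "_ * _"]
        distrib_right[of "\<iota> f"] distrib_right[of "\<iota> f * c _"])
qed

lemma Dunkl_parts_fscale:
  assumes "Dunkl_parts i f P1 P2"
  shows "Dunkl_parts i (fscale z f) (\<lambda>k. scale z (P1 k)) (\<lambda>k. scale z (P2 k))"
proof -
  note P = assms(1)[unfolded Dunkl_parts_def]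
  have "y i * \<iota> (fscale z f) = \<iota> (fscale z f) * y i
      - scale u (\<Sum>k\<in>-{i}. (scale z (P1 k) + scale z (P2 k)) * w \<langle>k \<leftrightarrow> i\<rangle>)"
    by (simp add: I.scale mult_scale_left mult_scale_right P scale_right_diff_distrib
        mult.commute flip: scale_right_distrib scale_sum_right)
  then show ?thesis
    using P by (simp add: Dunkl_parts_def generated_subalgebra.scale I.scale perm_mpoly_fscale
        mult_scale_left mult_scale_right scale_right_diff_distrib)
qed

text \<open>A twisted Leibniz rule: with s the swap, x_l f - s(x_l f) = x_l (f - s f) + (x_l -
  x_{s(l)}) s f, and likewise for the numerator with Clifford factors.\<close>

lemma Dunkl_parts_mvar_mult:
  assumes "Dunkl_parts i f P1 P2"
  shows "\<exists>Q1 Q2. Dunkl_parts i (mvar l * f) Q1 Q2"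
proof -
  have P: "\<And>k. k \<noteq> i \<Longrightarrow> P1 k \<in> XC" "\<And>k. k \<noteq> i \<Longrightarrow> P2 k \<in> XC"
      "\<And>k. k \<noteq> i \<Longrightarrow> (x i - x k) * P1 k = \<iota> f - \<iota> (perm_mpoly \<langle>k \<leftrightarrow> i\<rangle> f)"
      "\<And>k. k \<noteq> i \<Longrightarrow> (x i + x k) * P2 k = \<iota> f * c k * c i - c k * c i * \<iota> (perm_mpoly \<langle>k \<leftrightarrow> i\<rangle> f)"
    and y: "y i * \<iota> f = \<iota> f * y i - scale u (\<Sum>k\<in>-{i}. (P1 k + P2 k) * w \<langle>k \<leftrightarrow> i\<rangle>)"
    using assms unfolding Dunkl_parts_def by blast+
  define f' where "f' k = \<iota> (perm_mpoly \<langle>k \<leftrightarrow> i\<rangle> f)" for k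
  \<comment> \<open>The fractions belonging to the single variable x_l: \<open>d1 k\<close> is (x_l
    - x_{s(l)})/(x_i - x_k), and \<open>d2 k\<close> is the second fraction for f = x_l.\<close>
  define d1 where "d1 k = (if l = i then 1 else if l = k then - 1 else 0 :: 'h)" for k
  define d2 where "d2 k = (if l = i \<or> l = k then c k * c i else 0)" for k
  have x: "x j \<in> XC" and c: "c j \<in> XC" for j by (auto intro: generated_subalgebra.gen)
  have \<iota>_XC: "\<iota> g \<in> XC" for g
    by (induction g rule: mpoly_induct)
      (auto simp: I.hom_one I.hom_mult I.add I.scale \<iota>_mvar intro: x generated_subalgebra.intros)
  have "d1 k \<in> XC" for k
    using generated_subalgebra_diff[OF generated_subalgebra_zero generated_subalgebra.one]
    by (auto simp: d1_def generated_subalgebra_zero generated_subalgebra.one)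
  moreover have "d2 k \<in> XC" for k
    by (auto simp: d2_def generated_subalgebra_zero intro: generated_subalgebra.mult c)
  ultimately have XC: "x l * P1 k + d1 k * f' k \<in> XC" "x l * P2 k + d2 k * f' k \<in> XC" if "k \<noteq> i" for k
    using that P(1,2) x \<iota>_XC by (auto simp: f'_def intro!: generated_subalgebra.add generated_subalgebra.mult)
  have perm: "\<iota> (perm_mpoly \<langle>k \<leftrightarrow> i\<rangle> (mvar l * f)) = x (\<langle>k \<leftrightarrow> i\<rangle> \<langle>$\<rangle> l) * f' k" for k
    by (simp add: perm_mpoly_mult perm_mpoly_mvar I.hom_mult \<iota>_mvar f'_def)
  have \<iota>_mult: "\<iota> (mvar l * f) = x l * \<iota> f" by (simp add: I.hom_mult \<iota>_mvar)
  have fraction1: "(x i - x k) * (x l * P1 k + d1 k * f' k)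
      = \<iota> (mvar l * f) - \<iota> (perm_mpoly \<langle>k \<leftrightarrow> i\<rangle> (mvar l * f))" if "k \<noteq> i" for k
  proof -
    have "(x i - x k) * (x l * P1 k) = x l * ((x i - x k) * P1 k)"
      by (simp add: algebra_simps x_comm flip: mult.assoc)
    then show ?thesis
      unfolding perm \<iota>_mult distrib_left P(3)[OF that] f'_def[symmetric]
      using that by (cases "l = i"; cases "l = k") (auto simp: d1_def algebra_simps)
  qed
  have fraction2: "(x i + x k) * (x l * P2 k + d2 k * f' k)
      = \<iota> (mvar l * f) * c k * c i - c k * c i * \<iota> (perm_mpoly \<langle>k \<leftrightarrow> i\<rangle> (mvar l * f))" if "k \<noteq> i" for k
  proof -
    have cc: "c k * c i * x i = - (x i * (c k * c i))" "c k * c i * x k = - (x k * (c k * c i))"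
      using that x_c[of i k] x_c[of k i] x_c_same[of i] x_c_same[of k]
        x_c[of i k, THEN assoc_rule] x_c_same[of k, THEN assoc_rule]
      by (simp_all add: mult.assoc)
    have cc': "c k * c i * x j = x j * (c k * c i)" if "j \<noteq> i" "j \<noteq> k" for j
      using that x_c[of j i] x_c[of j k] by (simp add: mult.assoc assoc_rule[OF x_c[of j k]])
    have "(x i + x k) * (x l * P2 k) = x l * ((x i + x k) * P2 k)"
      by (simp add: algebra_simps x_comm flip: mult.assoc)
    then show ?thesis
      unfolding perm \<iota>_mult distrib_left P(4)[OF that] f'_def[symmetric]
      using that cc[THEN arg_cong[of _ _ "\<lambda>a. a * f' k"]] cc'[of l, THEN arg_cong[of _ _ "\<lambda>a. a * f' k"]]
      by (cases "l = i"; cases "l = k") (auto simp: d2_def algebra_simps)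
  qed
  \<comment> \<open>The two kinds of commutators of \<open>y\<close> and \<open>x\<close> merge into
    one formula. For l different from i only the summand k = l remains.\<close>
  have yx: "y i * x l = x l * y i - scale u (\<Sum>k\<in>-{i}. (d1 k + d2 k) * w \<langle>k \<leftrightarrow> i\<rangle>)"
  proof (cases "l = i")
    case True
    then show ?thesis by (simp add: y_x_same d1_def d2_def)
  next
    case False
    have "(\<Sum>k\<in>-{i}. (d1 k + d2 k) * w \<langle>k \<leftrightarrow> i\<rangle>)
        = (\<Sum>k\<in>-{i}. if k = l then (c l * c i - 1) * w \<langle>l \<leftrightarrow> i\<rangle> else 0)"
      using False by (intro sum.cong) (auto simp: d1_def d2_def)
    also have "\<dots> = - ((1 + c i * c l) * w \<langle>i \<leftrightarrow> l\<rangle>)"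
      using False c_anti[of i l] by (simp add: swap_sym[of i l] algebra_simps)
    finally show ?thesis using y_x[of l i] False by simp
  qed
  have sum_eq: "(\<Sum>k\<in>-{i}. ((x l * P1 k + d1 k * f' k) + (x l * P2 k + d2 k * f' k)) * w \<langle>k \<leftrightarrow> i\<rangle>)
      = x l * (\<Sum>k\<in>-{i}. (P1 k + P2 k) * w \<langle>k \<leftrightarrow> i\<rangle>)
        + (\<Sum>k\<in>-{i}. (d1 k + d2 k) * (f' k * w \<langle>k \<leftrightarrow> i\<rangle>))"
    unfolding sum_distrib_left sum.distrib[symmetric]
    by (intro sum.cong refl) (simp add: algebra_simps)
  have "y i * \<iota> (mvar l * f) = (y i * x l) * \<iota> f"
    unfolding \<iota>_mult by (simp only: mult.assoc)
  \<comment> \<open>The induction hypothesis handles \<open>y i * \<iota> f\<close>; in the other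
    sum the swap moves past \<open>\<iota> f\<close> and turns it into \<open>f' k\<close>.\<close>
  also have "\<dots> = x l * (y i * \<iota> f) - scale u (\<Sum>k\<in>-{i}. (d1 k + d2 k) * (w \<langle>k \<leftrightarrow> i\<rangle> * \<iota> f))"
    unfolding yx by (simp only: left_diff_distrib mult_scale_left sum_distrib_right mult.assoc)
  also have "\<dots> = \<iota> (mvar l * f) * y i - scale u (\<Sum>k\<in>-{i}.
      ((x l * P1 k + d1 k * f' k) + (x l * P2 k + d2 k * f' k)) * w \<langle>k \<leftrightarrow> i\<rangle>)"
    unfolding \<iota>_mult y w_\<iota> sum_eq f'_def[symmetric]
    by (simp only: right_diff_distrib mult_scale_right scale_right_distrib mult.assoc diff_diff_eq)
  finally have "Dunkl_parts i (mvar l * f) (\<lambda>k. x l * P1 k + d1 k * f' k) (\<lambda>k. x l * P2 k + d2 k * f' k)"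
    unfolding Dunkl_parts_def by (intro conjI allI impI XC fraction1 fraction2)
  then show ?thesis by blast
qed

lemma ex_Dunkl_parts: "\<exists>Q1 Q2. Dunkl_parts i f Q1 Q2"
  by (induction f rule: mpoly_induct)
    (use Dunkl_parts_one Dunkl_parts_add Dunkl_parts_fscale Dunkl_parts_mvar_mult in blast)+

end

section \<open>The induced module\<close>

context induced_module
begin

lemma tens_relator:
  assumes "r \<in> tensor_relators scaleA scaleM S actM"
  shows "lin_ext scaleV (case_prod tens) r = 0"
proof -
  interpret F: vector_space "fscale :: complex \<Rightarrow> ('a \<times> 'm \<Rightarrow>\<^sub>0 complex) \<Rightarrow> _"
    by (rule vector_space_fscale)
  \<comment> \<open>Identifies the sum over pairs in the axioms of the tensor product with a linear
    extension.\<close>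
  have "lin_ext scaleV (case_prod tens) p = (\<Sum>(a, m)\<in>Poly_Mapping.keys p.
      scaleV (Poly_Mapping.lookup p (a, m)) (tens a m))" for p
    unfolding lin_ext_def by (intro sum.cong) auto
  then show ?thesis using tensor_kernel F.span_base[OF assms] by auto
qed

lemma tens_lin_ext:
  "Vector_Spaces.linear fscale scaleV (lin_ext scaleV (case_prod tens))"
  "lin_ext scaleV (case_prod tens) (Poly_Mapping.single (a, m) 1) = tens a m"
  by (simp_all add: linear_lin_ext V.M.vector_space_axioms lin_ext_single[OF V.M.vector_space_axioms])

text \<open>Each identity says that a tensor relator is sent to zero by the class map.\<close>

lemma
  shows tens_add_left: "tens (a + b) m = tens a m + tens b m"
    and tens_scale_left: "tens (scaleA z a) m = scaleV z (tens a m)"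
    and tens_scale_right: "tens a (scaleM z m) = scaleV z (tens a m)"
    and tens_mult: "b \<in> S \<Longrightarrow> tens (a * b) m = tens a (actM b m)"
proof -
  interpret L: Vector_Spaces.linear fscale scaleV "lin_ext scaleV (case_prod tens)"
    by (rule tens_lin_ext)
  let ?e = "\<lambda>a m. Poly_Mapping.single (a, m) (1 :: complex)"
  let ?R = "tensor_relators scaleA scaleM S actM"
  have "?e (a + b) m - ?e a m - ?e b m \<in> ?R"
    "?e (scaleA z a) m - fscale z (?e a m) \<in> ?R" "?e a (scaleM z m) - fscale z (?e a m) \<in> ?R"
    "b \<in> S \<Longrightarrow> ?e (a * b) m - ?e a (actM b m) \<in> ?R"
    unfolding tensor_relators_def Let_def by blast+
  note this[THEN tens_relator]
  then show "tens (a + b) m = tens a m + tens b m"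
    "tens (scaleA z a) m = scaleV z (tens a m)" "tens a (scaleM z m) = scaleV z (tens a m)"
    "b \<in> S \<Longrightarrow> tens (a * b) m = tens a (actM b m)"
    unfolding L.diff L.scale tens_lin_ext(2) by (simp_all add: algebra_simps)
qed

lemma tens_zero_right: "tens a 0 = 0"
  using tens_scale_right[of a 0 0] by simp

lemma tens_diff_left: "tens (a - b) m = tens a m - tens b m"
  using tens_add_left[of "a - b" b m] by simp

lemma tens_sum_left: "tens (sum F A) m = (\<Sum>k\<in>A. tens (F k) m)"
proof (induction A rule: infinite_finite_induct)
  case empty
  show ?case using tens_scale_left[of 0 0 m] by simp
next
  case infinite
  then show ?case using tens_scale_left[of 0 0 m] by simp
qed (simp add: tens_add_left)

end

section \<open>The Dunkl operator formula\<close>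

theorem theorem4p4:
  fixes u :: complex
    and scaleK :: "complex \<Rightarrow> 'k::ring_1 \<Rightarrow> 'k"
    and \<kappa> :: "'n::finite kgen \<Rightarrow> 'k"
    and scaleH :: "complex \<Rightarrow> 'h::ring_1 \<Rightarrow> 'h"
    and \<gamma> :: "'n hgen \<Rightarrow> 'h"
    and j :: "'k \<Rightarrow> 'h"
    and \<iota> :: "'n mpoly \<Rightarrow> 'h"
    and scaleM :: "complex \<Rightarrow> 'm::ab_group_add \<Rightarrow> 'm"
    and actK :: "'k \<Rightarrow> 'm \<Rightarrow> 'm"
    and actM :: "'h \<Rightarrow> 'm \<Rightarrow> 'm"
    and scaleV :: "complex \<Rightarrow> 'v::ab_group_add \<Rightarrow> 'v"
    and actV :: "'h \<Rightarrow> 'v \<Rightarrow> 'v"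
    and tens :: "'h \<Rightarrow> 'm \<Rightarrow> 'v"
    and i :: 'n and f :: "'n mpoly" and m :: 'm
  defines "x \<equiv> \<lambda>i. \<gamma> (HX i)"
    and "y \<equiv> \<lambda>i. \<gamma> (HY i)"
    and "c \<equiv> \<lambda>i. \<gamma> (HC i)"
    and "w \<equiv> \<lambda>\<sigma>. \<gamma> (HW \<sigma>)"
  defines "Hy \<equiv> generated_subalgebra scaleH (range j \<union> range y)"
    and "XC \<equiv> generated_subalgebra scaleH (range x \<union> range c)"
  assumes K: "clifford_semidirect_algebra scaleK \<kappa>"
    and H: "rational_DAHCA u scaleH \<gamma>"
    and K_in_H: "algebra_hom scaleK scaleH j"
      "\<And>l. j (\<kappa> (KC l)) = c l" "\<And>\<sigma>. j (\<kappa> (KW \<sigma>)) = w \<sigma>"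
    and poly_in_H: "algebra_hom fscale scaleH \<iota>" "\<And>l. \<iota> (mvar l) = x l"
    and M_K_module: "algebra_module scaleK UNIV scaleM actK"
    and M_Hy_module: "algebra_module scaleH Hy scaleM actM"
      "\<And>a m. actM (j a) m = actK a m" "\<And>l m. actM (y l) m = 0"
    and induced: "induced_module scaleH Hy scaleM actM scaleV actV tens"
  shows "actV (y i) (tens (\<iota> f) m) =
    scaleV (- u) (\<Sum>k\<in>-{i}.
      tens (left_fraction XC (\<iota> f - \<iota> (perm_mpoly \<langle>k \<leftrightarrow> i\<rangle> f)) (x i - x k) +
            left_fraction XC (\<iota> f * c k * c i - c k * c i * \<iota> (perm_mpoly \<langle>k \<leftrightarrow> i\<rangle> f)) (x i + x k))
        (actK (\<kappa> (KW \<langle>k \<leftrightarrow> i\<rangle>)) m))"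
proof -
  interpret H: DAHCA_with_polynomials u scaleH \<gamma> \<iota>
    using H poly_in_H by (simp add: DAHCA_with_polynomials_def DAHCA_with_polynomials_axioms_def x_def)
  interpret V: induced_module scaleH Hy scaleM actM scaleV actV tens by (fact induced)
  obtain Q1 Q2 where "H.Dunkl_parts i f Q1 Q2" using H.ex_Dunkl_parts by blast
  then have XC: "Q1 k \<in> XC" "Q2 k \<in> XC"
    and Q1: "(x i - x k) * Q1 k = \<iota> f - \<iota> (perm_mpoly \<langle>k \<leftrightarrow> i\<rangle> f)"
    and Q2: "(x i + x k) * Q2 k = \<iota> f * c k * c i - c k * c i * \<iota> (perm_mpoly \<langle>k \<leftrightarrow> i\<rangle> f)"
    if "k \<noteq> i" for k
    using that unfolding H.Dunkl_parts_def XC_def x_def c_def by blast+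
  have y_f: "y i * \<iota> f = \<iota> f * y i - scaleH u (\<Sum>k\<in>-{i}. (Q1 k + Q2 k) * w \<langle>k \<leftrightarrow> i\<rangle>)"
    using \<open>H.Dunkl_parts i f Q1 Q2\<close> unfolding H.Dunkl_parts_def y_def w_def by blast
  have fractions: "left_fraction XC (\<iota> f - \<iota> (perm_mpoly \<langle>k \<leftrightarrow> i\<rangle> f)) (x i - x k) = Q1 k"
    "left_fraction XC (\<iota> f * c k * c i - c k * c i * \<iota> (perm_mpoly \<langle>k \<leftrightarrow> i\<rangle> f)) (x i + x k) = Q2 k"
    if "k \<noteq> i" for k
  proof -
    \<comment> \<open>Both denominators cancel in the subalgebra, so the constructed solutions are
      the only ones there.\<close>
    have cancel: "r = 0" if "r \<in> XC" "(x i - x k) * r = 0 \<or> (x i + x k) * r = 0" for r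
      using that H.XC_eq_0[OF K, of r _ i k] \<open>k \<noteq> i\<close> unfolding XC_def x_def c_def by auto
    show "left_fraction XC (\<iota> f - \<iota> (perm_mpoly \<langle>k \<leftrightarrow> i\<rangle> f)) (x i - x k) = Q1 k"
      unfolding XC_def
      by (rule H.left_fraction_eq) (use that XC Q1 cancel in \<open>simp_all add: XC_def\<close>)
    show "left_fraction XC (\<iota> f * c k * c i - c k * c i * \<iota> (perm_mpoly \<langle>k \<leftrightarrow> i\<rangle> f)) (x i + x k) = Q2 k"
      unfolding XC_def
      by (rule H.left_fraction_eq) (use that XC Q2 cancel in \<open>simp_all add: XC_def\<close>)
  qed
  have y_Hy: "y i \<in> Hy" and w_Hy: "w \<sigma> \<in> Hy" for \<sigma>
    unfolding Hy_def K_in_H(3)[symmetric] by (auto intro: generated_subalgebra.gen)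
  \<comment> \<open>Permutations lie in \<open>Hy\<close> through \<open>j\<close>, so they cross
    the tensor sign and act on \<open>M\<close> as elements of \<open>K\<close>.\<close>
  have w_act: "tens (q * w \<sigma>) m = tens q (actK (\<kappa> (KW \<sigma>)) m)" for q \<sigma>
    using V.tens_mult[OF w_Hy] M_Hy_module(2)[of "\<kappa> (KW \<sigma>)"] by (simp add: K_in_H(3))
  have "actV (y i) (tens (\<iota> f) m) = tens (y i * \<iota> f) m" by (rule V.act_tensor)
  \<comment> \<open>The first term moves \<open>y i\<close> across the tensor sign, where it acts on
    \<open>M\<close> by zero.\<close>
  also have "\<dots> = tens (\<iota> f) (actM (y i) m) - scaleV u (\<Sum>k\<in>-{i}. tens ((Q1 k + Q2 k) * w \<langle>k \<leftrightarrow> i\<rangle>) m)"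
    unfolding y_f by (simp only: V.tens_diff_left V.tens_scale_left V.tens_sum_left V.tens_mult[OF y_Hy])
  also have "\<dots> = scaleV (- u) (\<Sum>k\<in>-{i}. tens (Q1 k + Q2 k) (actK (\<kappa> (KW \<langle>k \<leftrightarrow> i\<rangle>)) m))"
    by (simp add: M_Hy_module(3) V.tens_zero_right w_act V.V.M.scale_minus_left)
  finally show ?thesis using fractions by (simp cong: sum.cong_simp)
qed

end
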